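(* Let $G$ be a connected finite-dimensional Lie group with Lie algebra $\mathfrak{g}$, $M$ a smooth connected manifold, $h\colon G\times M\to M$ a smooth transitive right action, $y_0\in M$, and $h_{y_0}\colon G\to M$, $h_{y_0}(X)=h(X,y_0)$. The left invariant system with complementary observations $$\dot X = Xu,\qquad y = h_{y_0}(X)$$ projects to the system $$\dot y = T_X h_{y_0}(Xu),\qquad X\in h_{y_0}^{-1}(y)=\{X\in G \mid h(X,y_0)=y\},$$ on $M$ (with output map the identity of $M$).
   Context: Right action means $h(X,h(Y,y))=h(YX,y)$ for all $X,Y\in G$, $y\in M$; transitive means that for all $x,y\in M$ there is $X\in G$ with $h(X,x)=y$. For $X\in G$, $u\in\mathfrak{g}$, $Xu := T_eL_X u\in T_XG$, where $L_X$ is left multiplication. An input $u\colon\mathbb{R}\to\mathfrak{g}$ is admissible if the time-variant differential equation $\dot X=Xu(t)$ on $G$ has unique solutions for all initial values. "Complementary observations" means that the output is generated by an action of opposite handedness to the invariance of the system (here: right action, left invariant system). A system on a manifold $N$ with input space $\mathfrak{g}$ is a smooth bundle map $N\times\mathfrak{g}\to TN$. "The system on $G$ projects to the system on $M$" means: (i) the map $\tilde f\colon M\times\mathfrak{g}\to TM$, $\tilde f(y,u)=T_Xh_{y_0}(Xu)$ for $X\in h_{y_0}^{-1}(y)$, is well defined (independent of the choice of $X\in h_{y_0}^{-1}(y)$) and is a system on $M$, so that $T_Xh_{y_0}(Xu)=\tilde f(h_{y_0}(X),u)$ for all $X\in G$, $u\in\mathfrak{g}$; and (ii) the system $\dot X=Xu$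 with output $y=h_{y_0}(X)$ and the system $\dot y=\tilde f(y,u)$ with full state output have the same input-output behaviour: for every admissible $u$ and every solution $X(t)$ of $\dot X=Xu$, the output $h_{y_0}(X(t))$ equals the solution $y(t)$ of $\dot y=\tilde f(y,u)$ with $y(0)=h_{y_0}(X(0))$, and every solution of the latter system arises in this way. *)

theory Defs
  imports "HOL-Analysis.Analysis" "HOL-Algebra.Group"
begin

section \<open>Smooth maps between normed vector spaces\<close>

text \<open>The sets \<open>S\<close> below are open and the spaces finite-dimensional in all uses. Then
  continuity of all iterated directional derivatives is the usual notion of \<open>C\<^sup>n\<close>.\<close>

primrec times_cont_diff_on ::
    "nat \<Rightarrow> 'a::real_normed_vector set \<Rightarrow> ('a \<Rightarrow> 'b::real_normed_vector) \<Rightarrow> bool" where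
  "times_cont_diff_on 0 S f \<longleftrightarrow> continuous_on S f"
| "times_cont_diff_on (Suc n) S f \<longleftrightarrow>
     (\<forall>x\<in>S. f differentiable (at x)) \<and>
     (\<forall>v. times_cont_diff_on n S (\<lambda>x. frechet_derivative f (at x) v))"

definition smooth_on ::
    "'a::real_normed_vector set \<Rightarrow> ('a \<Rightarrow> 'b::real_normed_vector) \<Rightarrow> bool" where
  "smooth_on S f \<longleftrightarrow> (\<forall>n. times_cont_diff_on n S f)"


section \<open>Smooth manifolds\<close>

text \<open>A chart is a domain together with a coordinate map, which is meaningful on the domain
  only. Model spaces are finite-dimensional types of class \<open>real_normed_vector\<close> rather than of
  class \<open>euclidean_space\<close>, because the latter excludes dimension zero (and hence
  one-point manifolds and the trivial Lie group).\<close>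

type_synonym ('a, 'e) chart = "'a set \<times> ('a \<Rightarrow> 'e)"
type_synonym ('a, 'e) atlas = "('a, 'e) chart set"

definition points :: "('a, 'e) atlas \<Rightarrow> 'a set" where
  "points A = (\<Union>c\<in>A. fst c)"

text \<open>The topology determined by an atlas, for which the charts are homeomorphisms onto
  open sets.\<close>

definition mtop :: "('a, 'e::real_normed_vector) atlas \<Rightarrow> 'a topology" where
  "mtop A = topology (\<lambda>W. W \<subseteq> points A \<and> (\<forall>c\<in>A. open (snd c ` (W \<inter> fst c))))"

text \<open>Coordinate representation \<open>\<psi> \<circ> f \<circ> \<phi>\<inverse>\<close> of a map \<open>f\<close>, with \<open>\<phi>\<close> the chart
  \<open>c\<close> and \<open>\<psi>\<close> the chart \<open>d\<close>.\<close>

definition coord_rep :: "('a, 'e) chart \<Rightarrow> ('b, 'f) chart \<Rightarrow> ('a \<Rightarrow> 'b) \<Rightarrow> 'e \<Rightarrow> 'f" where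
  "coord_rep c d f = (\<lambda>x. snd d (f (inv_into (fst c) (snd c) x)))"

definition smooth_manifold :: "('a, 'e::real_normed_vector) atlas \<Rightarrow> bool" where
  "smooth_manifold A \<longleftrightarrow>
     (\<exists>B::'e set. finite B \<and> span B = UNIV) \<and>
     (\<forall>c\<in>A. inj_on (snd c) (fst c)) \<and>
     (\<forall>c\<in>A. \<forall>d\<in>A. open (snd c ` (fst c \<inter> fst d)) \<and>
        smooth_on (snd c ` (fst c \<inter> fst d)) (coord_rep c d (\<lambda>p. p))) \<and>
     Hausdorff_space (mtop A) \<and> second_countable (mtop A)"

lemma openin_mtop:
  assumes "smooth_manifold A"
  shows "openin (mtop A) W \<longleftrightarrow> W \<subseteq> points A \<and> (\<forall>c\<in>A. open (snd c ` (W \<inter> fst c)))"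
proof -
  let ?L = "\<lambda>W. W \<subseteq> points A \<and> (\<forall>c\<in>A. open (snd c ` (W \<inter> fst c)))"
  have inj: "inj_on (snd c) (fst c)" if "c \<in> A" for c
    using assms that by (auto simp: smooth_manifold_def)
  have "istopology ?L"
    unfolding istopology_def
  proof (intro conjI allI impI)
    fix S T assume S: "?L S" and T: "?L T"
    have "open (snd c ` ((S \<inter> T) \<inter> fst c))" if "c \<in> A" for c
    proof -
      have "snd c ` ((S \<inter> T) \<inter> fst c) = snd c ` (S \<inter> fst c) \<inter> snd c ` (T \<inter> fst c)"
        using inj[OF that] by (auto simp: inj_on_def)
      then show ?thesis using S T that by auto
    qed
    then show "S \<inter> T \<subseteq> points A" "\<forall>c\<in>A. open (snd c ` ((S \<inter> T) \<inter> fst c))"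
      using S by auto
  next
    fix \<K> assume K: "\<forall>K\<in>\<K>. ?L K"
    then show "\<Union>\<K> \<subseteq> points A" by blast
    have "open (snd c ` (\<Union>\<K> \<inter> fst c))" if "c \<in> A" for c
    proof -
      have "snd c ` (\<Union>\<K> \<inter> fst c) = (\<Union>K\<in>\<K>. snd c ` (K \<inter> fst c))"
        by blast
      moreover have "open (\<Union>K\<in>\<K>. snd c ` (K \<inter> fst c))"
        using K that by (intro open_UN) blast
      ultimately show ?thesis by simp
    qed
    then show "\<forall>c\<in>A. open (snd c ` (\<Union>\<K> \<inter> fst c))" by blast
  qed
  then show ?thesis by (simp add: mtop_def)
qed

definition smooth_map ::
    "('a, 'e::real_normed_vector) atlas \<Rightarrow> ('b, 'f::real_normed_vector) atlas \<Rightarrow>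
     ('a \<Rightarrow> 'b) \<Rightarrow> bool" where
  "smooth_map A B f \<longleftrightarrow>
     continuous_map (mtop A) (mtop B) f \<and>
     (\<forall>c\<in>A. \<forall>d\<in>B. smooth_on (snd c ` (fst c \<inter> f -` fst d)) (coord_rep c d f))"

definition prod_atlas :: "('a, 'e) atlas \<Rightarrow> ('b, 'f) atlas \<Rightarrow> ('a \<times> 'b, 'e \<times> 'f) atlas" where
  "prod_atlas A B = (\<lambda>(c, d). (fst c \<times> fst d, map_prod (snd c) (snd d))) ` (A \<times> B)"


section \<open>Tangent vectors\<close>

text \<open>A tangent vector at \<open>p\<close> is a family of coordinate vectors, one for each chart of the atlas
  around \<open>p\<close>, related by the derivatives of the transition maps. The value is set to 0 on all
  other arguments, so that families are equal iff they agree on the charts around \<open>p\<close>.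
  Vector space operations are pointwise.\<close>

type_synonym ('a, 'e) tangent_vec = "('a, 'e) chart \<Rightarrow> 'e"

definition tangent_space ::
    "('a, 'e::real_normed_vector) atlas \<Rightarrow> 'a \<Rightarrow> ('a, 'e) tangent_vec set" where
  "tangent_space A p =
     {v. (\<forall>c. \<not> (c \<in> A \<and> p \<in> fst c) \<longrightarrow> v c = 0) \<and>
         (\<forall>c\<in>A. \<forall>d\<in>A. p \<in> fst c \<and> p \<in> fst d \<longrightarrow>
            v d = frechet_derivative (coord_rep c d (\<lambda>q. q)) (at (snd c p)) (v c))}"

text \<open>The tangent space as a manifold, with its standard smooth structure as a
  finite-dimensional vector space: each chart around \<open>p\<close> gives a linear isomorphism onto the
  model space.\<close>

definition tangent_space_atlas ::
    "('a, 'e::real_normed_vector) atlas \<Rightarrow> 'a \<Rightarrow> (('a, 'e) tangent_vec, 'e) atlas" where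
  "tangent_space_atlas A p = (\<lambda>c. (tangent_space A p, \<lambda>v. v c)) ` {c \<in> A. p \<in> fst c}"

text \<open>The tangent bundle, as a manifold whose points are the pairs \<open>(p, v)\<close> with \<open>v\<close> in the
  tangent space at \<open>p\<close>.\<close>

definition tangent_bundle_atlas ::
    "('a, 'e::real_normed_vector) atlas \<Rightarrow> ('a \<times> ('a, 'e) tangent_vec, 'e \<times> 'e) atlas" where
  "tangent_bundle_atlas A =
     (\<lambda>c. (Sigma (fst c) (tangent_space A), \<lambda>(p, v). (snd c p, v c))) ` A"

text \<open>The tangent map \<open>(p, v) \<mapsto> (f p, T\<^sub>p f v)\<close>. For smooth \<open>f\<close> the result does not depend on the
  chart selected at \<open>p\<close>.\<close>

definition tangent_map ::
    "('a, 'e::real_normed_vector) atlas \<Rightarrow> ('b, 'f::real_normed_vector) atlas \<Rightarrow> ('a \<Rightarrow> 'b) \<Rightarrow>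
     'a \<times> ('a, 'e) tangent_vec \<Rightarrow> 'b \<times> ('b, 'f) tangent_vec" where
  "tangent_map A B f = (\<lambda>(p, v).
     (f p,
      \<lambda>d. if d \<in> B \<and> f p \<in> fst d
          then let c = (SOME c. c \<in> A \<and> p \<in> fst c)
               in frechet_derivative (coord_rep c d f) (at (snd c p)) (v c)
          else 0))"

text \<open>The curve \<open>\<gamma>\<close>, assumed continuous near \<open>t\<close>, has derivative \<open>w\<close> (an element of the tangent
  bundle) at time \<open>t\<close>.\<close>

definition has_velocity ::
    "('a, 'e::real_normed_vector) atlas \<Rightarrow> (real \<Rightarrow> 'a) \<Rightarrow> 'a \<times> ('a, 'e) tangent_vec \<Rightarrow>
     real \<Rightarrow> bool" where
  "has_velocity A \<gamma> w t \<longleftrightarrow>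
     fst w = \<gamma> t \<and>
     (\<forall>c\<in>A. \<gamma> t \<in> fst c \<longrightarrow> ((\<lambda>s. snd c (\<gamma> s)) has_vector_derivative snd w c) (at t))"


section \<open>Systems and projections\<close>

text \<open>A system on \<open>N\<close> with input manifold \<open>V\<close> is a smooth bundle map from \<open>N \<times> V\<close> to the tangent
  bundle of \<open>N\<close>, over the identity of \<open>N\<close>.\<close>

definition is_system ::
    "('a, 'e::real_normed_vector) atlas \<Rightarrow> ('i, 'v::real_normed_vector) atlas \<Rightarrow>
     ('a \<times> 'i \<Rightarrow> 'a \<times> ('a, 'e) tangent_vec) \<Rightarrow> bool" where
  "is_system N V f \<longleftrightarrow>
     smooth_map (prod_atlas N V) (tangent_bundle_atlas N) f \<and>
     (\<forall>y\<in>points N. \<forall>u\<in>points V. fst (f (y, u)) = y)"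

text \<open>Solutions on an open interval \<open>J\<close> for the input \<open>u\<close>.\<close>

definition solution ::
    "('a, 'e::real_normed_vector) atlas \<Rightarrow> ('a \<times> 'i \<Rightarrow> 'a \<times> ('a, 'e) tangent_vec) \<Rightarrow>
     (real \<Rightarrow> 'i) \<Rightarrow> real set \<Rightarrow> (real \<Rightarrow> 'a) \<Rightarrow> bool" where
  "solution N f u J \<gamma> \<longleftrightarrow>
     continuous_map (top_of_set J) (mtop N) \<gamma> \<and>
     (\<forall>t\<in>J. has_velocity N \<gamma> (f (\<gamma> t, u t)) t)"

definition admissible ::
    "('a, 'e::real_normed_vector) atlas \<Rightarrow> ('i, 'v::real_normed_vector) atlas \<Rightarrow>
     ('a \<times> 'i \<Rightarrow> 'a \<times> ('a, 'e) tangent_vec) \<Rightarrow> (real \<Rightarrow> 'i) \<Rightarrow> bool" where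
  "admissible N V f u \<longleftrightarrow>
     (\<forall>t. u t \<in> points V) \<and>
     (\<forall>x\<in>points N. \<exists>!\<gamma>. solution N f u UNIV \<gamma> \<and> \<gamma> 0 = x)"

text \<open>The input-output behaviour of \<open>f\<close> on \<open>N\<close> with output map \<open>k\<close> agrees with that of \<open>F\<close> on
  \<open>M\<close> with full state output. The quantification over \<open>J\<close> includes the whole real line.\<close>

definition same_io_behaviour ::
    "('a, 'e::real_normed_vector) atlas \<Rightarrow> ('i, 'v::real_normed_vector) atlas \<Rightarrow>
     ('a \<times> 'i \<Rightarrow> 'a \<times> ('a, 'e) tangent_vec) \<Rightarrow> ('a \<Rightarrow> 'b) \<Rightarrow>
     ('b, 'f::real_normed_vector) atlas \<Rightarrow> ('b \<times> 'i \<Rightarrow> 'b \<times> ('b, 'f) tangent_vec) \<Rightarrow> bool" where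
  "same_io_behaviour N V f k M F \<longleftrightarrow>
     (\<forall>u. admissible N V f u \<longrightarrow>
       (\<forall>J. open J \<and> is_interval J \<and> 0 \<in> J \<longrightarrow>
         (\<forall>X. solution N f u J X \<longrightarrow>
            solution M F u J (\<lambda>t. k (X t)) \<and>
            (\<forall>y. solution M F u J y \<and> y 0 = k (X 0) \<longrightarrow> (\<forall>t\<in>J. k (X t) = y t))) \<and>
         (\<forall>y. solution M F u J y \<longrightarrow>
            (\<exists>X. solution N f u J X \<and> (\<forall>t\<in>J. k (X t) = y t)))))"

text \<open>The right-hand side \<open>(y, u) \<mapsto> T\<^sub>X k (f (X, u))\<close>, for some choice of \<open>X\<close> in the fibre of \<open>k\<close>
  over \<open>y\<close>.\<close>

definition projected_rhs ::
    "('a, 'e::real_normed_vector) atlas \<Rightarrow> ('a \<times> 'i \<Rightarrow> 'a \<times> ('a, 'e) tangent_vec) \<Rightarrow>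
     ('a \<Rightarrow> 'b) \<Rightarrow> ('b, 'f::real_normed_vector) atlas \<Rightarrow>
     'b \<times> 'i \<Rightarrow> 'b \<times> ('b, 'f) tangent_vec" where
  "projected_rhs N f k M = (\<lambda>(y, u).
     tangent_map N M k (f (SOME X. X \<in> points N \<and> k X = y, u)))"

definition projects ::
    "('a, 'e::real_normed_vector) atlas \<Rightarrow> ('i, 'v::real_normed_vector) atlas \<Rightarrow>
     ('a \<times> 'i \<Rightarrow> 'a \<times> ('a, 'e) tangent_vec) \<Rightarrow> ('a \<Rightarrow> 'b) \<Rightarrow>
     ('b, 'f::real_normed_vector) atlas \<Rightarrow> bool" where
  "projects N V f k M \<longleftrightarrow>
     (\<forall>y\<in>points M. \<exists>X\<in>points N. k X = y) \<and>
     (\<forall>X\<in>points N. \<forall>X'\<in>points N. \<forall>u\<in>points V. k X = k X' \<longrightarrow>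
        tangent_map N M k (f (X, u)) = tangent_map N M k (f (X', u))) \<and>
     is_system M V (projected_rhs N f k M) \<and>
     (\<forall>X\<in>points N. \<forall>u\<in>points V.
        tangent_map N M k (f (X, u)) = projected_rhs N f k M (k X, u)) \<and>
     same_io_behaviour N V f k M (projected_rhs N f k M)"


section \<open>Lie groups and actions\<close>

definition lie_group ::
    "('a, 'm) monoid_scheme \<Rightarrow> ('a, 'e::real_normed_vector) atlas \<Rightarrow> bool" where
  "lie_group G A \<longleftrightarrow>
     group G \<and> smooth_manifold A \<and> carrier G = points A \<and>
     smooth_map (prod_atlas A A) A (\<lambda>(X, Y). X \<otimes>\<^bsub>G\<^esub> Y) \<and>
     smooth_map A A (\<lambda>X. inv\<^bsub>G\<^esub> X)"

text \<open>The Lie algebra (as a vector space) is the tangent space at the identity.\<close>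

definition lie_algebra_atlas ::
    "('a, 'm) monoid_scheme \<Rightarrow> ('a, 'e::real_normed_vector) atlas \<Rightarrow>
     (('a, 'e) tangent_vec, 'e) atlas" where
  "lie_algebra_atlas G A = tangent_space_atlas A \<one>\<^bsub>G\<^esub>"

text \<open>The right-hand side of \<open>X' = X u\<close>, where \<open>X u\<close> is the image of \<open>u\<close> under the tangent map at
  the identity of left multiplication by \<open>X\<close>.\<close>

definition left_invariant_rhs ::
    "('a, 'm) monoid_scheme \<Rightarrow> ('a, 'e::real_normed_vector) atlas \<Rightarrow>
     'a \<times> ('a, 'e) tangent_vec \<Rightarrow> 'a \<times> ('a, 'e) tangent_vec" where
  "left_invariant_rhs G A = (\<lambda>(X, u). tangent_map A A (\<lambda>Y. X \<otimes>\<^bsub>G\<^esub> Y) (\<one>\<^bsub>G\<^esub>, u))"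

text \<open>The unit law \<open>h \<one> y = y\<close> is not demanded; it follows for transitive actions.\<close>

definition right_action ::
    "('a, 'm) monoid_scheme \<Rightarrow> 'b set \<Rightarrow> ('a \<Rightarrow> 'b \<Rightarrow> 'b) \<Rightarrow> bool" where
  "right_action G S h \<longleftrightarrow>
     (\<forall>X\<in>carrier G. \<forall>y\<in>S. h X y \<in> S) \<and>
     (\<forall>X\<in>carrier G. \<forall>Y\<in>carrier G. \<forall>y\<in>S. h X (h Y y) = h (Y \<otimes>\<^bsub>G\<^esub> X) y)"

definition transitive_action ::
    "('a, 'm) monoid_scheme \<Rightarrow> 'b set \<Rightarrow> ('a \<Rightarrow> 'b \<Rightarrow> 'b) \<Rightarrow> bool" where
  "transitive_action G S h \<longleftrightarrow> (\<forall>x\<in>S. \<forall>y\<in>S. \<exists>X\<in>carrier G. h X x = y)"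

end

theory Submission
  imports Defs
begin

text \<open>
  Write \<open>k X = h X y0\<close> for the orbit map. The right action law says
  \<open>k (X \<otimes> Y) = h Y (k X)\<close>, that is, left translation by \<open>X\<close> followed by \<open>k\<close> is the orbit map
  of the point \<open>k X\<close>. Differentiating at \<open>Y = \<one>\<close> gives \<open>T\<^sub>X k (X u) = T\<^sub>\<one> h(\<cdot>, k X) u\<close>, whose
  right-hand side depends on \<open>X\<close> only through \<open>y = k X\<close> (lemma \<open>orbit_map_left_invariant\<close>). So the
  projected right-hand side is well defined and equals the infinitesimal action
  \<open>(y, u) \<mapsto> T\<^sub>\<one> h(\<cdot>, y) u\<close>. This formula also shows smoothness: it is a partial derivative of the
  smooth map \<open>h\<close>, evaluated at \<open>(\<one>, y)\<close> in the direction \<open>(u, 0)\<close>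
  (lemma \<open>smooth_infinitesimal_action\<close>).

  For the input-output behaviour, the chain rule shows that orbit curves \<open>h (X t) y\<close> of a solution
  \<open>X\<close> solve the projected equation, for every initial point \<open>y\<close> (lemma \<open>orbit_of_solution\<close>).
  Uniqueness is a consequence of the group structure: if \<open>y\<close> solves the projected equation along with \<open>X\<close>, then
  \<open>z t = h (inv (X t)) (y t)\<close> has velocity zero everywhere, hence is constant, and
  \<open>y t = h (X t) (z t)\<close> is the orbit curve of a fixed point (lemma \<open>solution_is_orbit\<close>). The velocity of
  \<open>z\<close> at a time \<open>s\<close> vanishes because \<open>y\<close> and the orbit curve \<open>h (X t) (z s)\<close> have the same value
  and the same velocity at \<open>s\<close>, and replacing \<open>y\<close> by this orbit curve turns \<open>z\<close> into a constant.
  Finally, every solution of the projected equation is an output: admissibility of the input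
  supplies a solution \<open>X\<close> starting in the fibre over \<open>y 0\<close>, and uniqueness identifies \<open>y\<close>
  with its output.

  All derivatives are taken in charts. Curves are treated as maps out of an interval with the
  identity as its only chart, so that velocities obey the same chain rule as every other derivative.\<close>

section \<open>Linear functionals in finite dimension\<close>

text \<open>The model spaces are finite-dimensional, but carry an arbitrary norm and no inner product. That
  coordinates with respect to a basis are bounded then needs the equivalence of norms: the given
  norm has a positive minimum on the compact set of coefficient vectors of \<open>\<ell>\<^sup>1\<close>-norm one.\<close>

lemma finite_dim_coordinate_bounded:
  fixes B :: "'e::real_normed_vector set"
  assumes fin: "finite B" and ind: "independent B" and span: "span B = UNIV"
  shows "bounded_linear (\<lambda>v. representation B v b)"
proof -
  let ?lc = "\<lambda>u. \<Sum>b\<in>B. u b *\<^sub>R b"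
  let ?r = "\<lambda>v b. representation B v b"
  \<comment> \<open>The \<open>\<ell>\<^sup>1\<close> unit sphere. The coefficients outside \<open>B\<close> are fixed to 0, so that
    it is a closed subset of a product of compact intervals.\<close>
  define K where "K = (\<Pi>\<^sub>E b\<in>UNIV. if b \<in> B then {-1..1::real} else {0})
     \<inter> (\<lambda>u. \<Sum>b\<in>B. \<bar>u b\<bar>) -` {1}"
  have lin: "linear (\<lambda>v. ?r v b)" for b
    using real_vector.linear_representation[OF ind span]
    unfolding linear_def by (simp add: real_scaleR_def[abs_def])
  have rep: "?lc (?r v) = v" for v
    using real_vector.sum_representation_eq[OF ind _ fin order_refl] span by auto
  have outside: "?r v b = 0" if "b \<notin> B" for v b
    using that real_vector.representation_ne_zero by fastforce
  have "compact (\<Pi>\<^sub>E b\<in>UNIV. if b \<in> B then {-1..1::real} else {0})"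
  proof -
    have "compactin (product_topology (\<lambda>_. euclidean) UNIV)
        (\<Pi>\<^sub>E b\<in>UNIV. if b \<in> B then {-1..1::real} else {0})"
      unfolding compactin_PiE by auto
    then show ?thesis by (simp add: euclidean_product_topology)
  qed
  moreover have "continuous_on UNIV (\<lambda>u. \<Sum>b\<in>B. \<bar>u b :: real\<bar>)"
    by (intro continuous_on_sum continuous_on_rabs continuous_on_product_coordinates)
  then have "closed ((\<lambda>u. \<Sum>b\<in>B. \<bar>u b :: real\<bar>) -` {1})"
    by (intro closed_vimage closed_singleton)
  ultimately have "compact K"
    unfolding K_def by (rule compact_Int_closed)
  have K_norm: "?lc u \<noteq> 0" if "u \<in> K" for u
  proof
    assume "?lc u = 0"
    then have "u b = 0" if "b \<in> B" for b
      using ind that fin by (auto simp: dependent_finite)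
    then show False using that by (simp add: K_def)
  qed
  obtain m where m: "m > 0" "\<And>u. u \<in> K \<Longrightarrow> m \<le> norm (?lc u)"
  proof (cases "K = {}")
    case True
    then show ?thesis using that[of 1] by simp
  next
    case False
    have "continuous_on K (\<lambda>u. norm (?lc u))"
      by (intro continuous_intros continuous_on_product_then_coordinatewise[OF continuous_on_id])
    from continuous_attains_inf[OF \<open>compact K\<close> False this]
    obtain u where "u \<in> K" "\<And>w. w \<in> K \<Longrightarrow> norm (?lc u) \<le> norm (?lc w)" by blast
    then show ?thesis using that[of "norm (?lc u)"] K_norm by auto
  qed
  have bound: "m * (\<Sum>b\<in>B. \<bar>?r v b\<bar>) \<le> norm v" for v
  proof (cases "(\<Sum>b\<in>B. \<bar>?r v b\<bar>) = 0")
    case False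
    define s where "s = (\<Sum>b\<in>B. \<bar>?r v b\<bar>)"
    have s: "s > 0" using False by (simp add: s_def sum_nonneg less_le)
    have le: "\<bar>?r v b\<bar> \<le> s" if "b \<in> B" for b
      unfolding s_def using that fin by (intro member_le_sum) auto
    have "(\<lambda>b. ?r v b / s) \<in> K"
      using s le outside unfolding K_def
      by (auto simp: abs_le_iff divide_simps sum_divide_distrib[symmetric] s_def[symmetric]; fastforce)
    then have "m \<le> norm (\<Sum>b\<in>B. (?r v b / s) *\<^sub>R b)" using m by blast
    also have "(\<Sum>b\<in>B. (?r v b / s) *\<^sub>R b) = (1 / s) *\<^sub>R ?lc (?r v)"
      by (simp add: scaleR_sum_right)
    also have "norm \<dots> = norm v / s" using s rep by simp
    finally show ?thesis using s by (simp add: s_def field_simps)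
  qed (simp)
  have "\<bar>?r v b\<bar> \<le> norm v * (1 / m)" for v
  proof (cases "b \<in> B")
    case True
    then have "\<bar>?r v b\<bar> \<le> (\<Sum>b\<in>B. \<bar>?r v b\<bar>)"
      using fin by (intro member_le_sum) auto
    then have "m * \<bar>?r v b\<bar> \<le> norm v" using bound[of v] m(1)
      by (meson mult_left_mono less_imp_le order_trans)
    then show ?thesis using m(1) by (simp add: field_simps)
  qed (use m(1) outside in simp)
  then show ?thesis
    by (intro bounded_linear_intro[where K = "1/m"])
      (auto simp: linear_add[OF lin] linear_scale[OF lin])
qed

section \<open>Calculus of \<open>C\<^sup>n\<close> maps\<close>

lemma times_cont_diff_on_cong:
  assumes "open S" and "\<And>x. x \<in> S \<Longrightarrow> f x = g x" and "times_cont_diff_on n S f"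
  shows "times_cont_diff_on n S g"
  using assms(2,3)
proof (induction n arbitrary: f g)
  case 0
  then show ?case using continuous_on_cong by force
next
  case (Suc n)
  have d: "g differentiable (at x) \<and> frechet_derivative g (at x) = frechet_derivative f (at x)"
    if "x \<in> S" for x
  proof -
    have "(f has_derivative frechet_derivative f (at x)) (at x)"
      using Suc.prems that by (simp add: frechet_derivative_works)
    then have "(g has_derivative frechet_derivative f (at x)) (at x)"
      by (rule has_derivative_transform_within_open[OF _ \<open>open S\<close> that Suc.prems(1)])
    then show ?thesis
      using frechet_derivative_at differentiableI by metis
  qed
  show ?case using Suc d by auto
qed

lemma times_cont_diff_on_weaken:
  "times_cont_diff_on (Suc n) S f \<Longrightarrow> times_cont_diff_on n S f"
proof (induction n arbitrary: f)
  case 0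
  then show ?case
    by (auto intro!: continuous_at_imp_continuous_on differentiable_imp_continuous_within)
next
  case (Suc n)
  then show ?case
    by (metis times_cont_diff_on.simps(2))
qed

lemma times_cont_diff_on_const: "times_cont_diff_on n S (\<lambda>_. c)"
  by (induction n arbitrary: c) auto

lemma times_cont_diff_on_bounded_linear:
  assumes "bounded_linear f" shows "times_cont_diff_on n S f"
proof (cases n)
  case 0
  then show ?thesis using assms by (simp add: linear_continuous_on)
next
  case (Suc k)
  have f: "(f has_derivative f) (at x)" for x
    using assms by (rule bounded_linear_imp_has_derivative)
  then have "frechet_derivative f (at x) = f" for x
    using frechet_derivative_at by metis
  then show ?thesis
    using f by (auto simp: Suc times_cont_diff_on_const differentiable_def)
qed

text \<open>The induction step of the closure properties below, where a rule of calculus supplies the derivative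
  at the points of \<open>S\<close>. As \<open>S\<close> is open, this determines \<^const>\<open>frechet_derivative\<close> near each of them.\<close>

lemma times_cont_diff_on_Suc_I:
  assumes "open S" and "\<And>x. x \<in> S \<Longrightarrow> (f has_derivative f' x) (at x)"
    and "\<And>v. times_cont_diff_on n S (\<lambda>x. f' x v)"
  shows "times_cont_diff_on (Suc n) S f"
proof -
  have "f' x = frechet_derivative f (at x)" if "x \<in> S" for x
    using assms(2)[OF that] by (rule frechet_derivative_at)
  then have "times_cont_diff_on n S (\<lambda>x. frechet_derivative f (at x) v)" for v
    by (intro times_cont_diff_on_cong[OF \<open>open S\<close> _ assms(3)]) auto
  then show ?thesis
    using assms(2) by (auto simp: differentiable_def)
qed

lemma times_cont_diff_on_SucD:
  assumes "times_cont_diff_on (Suc n) S f" "x \<in> S"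
  shows "(f has_derivative frechet_derivative f (at x)) (at x)"
  using assms by (simp add: frechet_derivative_works)

lemma times_cont_diff_on_add:
  assumes "open S"
  shows "times_cont_diff_on n S f \<Longrightarrow> times_cont_diff_on n S g \<Longrightarrow>
    times_cont_diff_on n S (\<lambda>x. f x + g x)"
proof (induction n arbitrary: f g)
  case (Suc n)
  show ?case
    by (rule times_cont_diff_on_Suc_I[OF \<open>open S\<close>
          has_derivative_add[OF Suc.prems[THEN times_cont_diff_on_SucD]]])
      (use Suc in auto)
qed (auto intro: continuous_on_add)

lemma times_cont_diff_on_sum:
  assumes "open S" and "\<And>i. i \<in> I \<Longrightarrow> times_cont_diff_on n S (f i)"
  shows "times_cont_diff_on n S (\<lambda>x. \<Sum>i\<in>I. f i x)"
  using assms(2)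
  by (induction I rule: infinite_finite_induct)
    (auto intro!: times_cont_diff_on_const times_cont_diff_on_add[OF \<open>open S\<close>])

lemma times_cont_diff_on_Pair:
  assumes "open S"
  shows "times_cont_diff_on n S f \<Longrightarrow> times_cont_diff_on n S g \<Longrightarrow>
    times_cont_diff_on n S (\<lambda>x. (f x, g x))"
proof (induction n arbitrary: f g)
  case (Suc n)
  show ?case
    by (rule times_cont_diff_on_Suc_I[OF \<open>open S\<close>
          has_derivative_Pair[OF Suc.prems[THEN times_cont_diff_on_SucD]]])
      (use Suc in auto)
qed (auto intro: continuous_on_Pair)

lemma times_cont_diff_on_scaleR:
  assumes "open S"
  shows "times_cont_diff_on n S f \<Longrightarrow> times_cont_diff_on n S g \<Longrightarrow>
    times_cont_diff_on n S (\<lambda>x. f x *\<^sub>R g x)"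
proof (induction n arbitrary: f g)
  case (Suc n)
  show ?case
    by (rule times_cont_diff_on_Suc_I[OF \<open>open S\<close>
          has_derivative_scaleR[OF Suc.prems[THEN times_cont_diff_on_SucD]]])
      (use Suc Suc.prems[THEN times_cont_diff_on_weaken] in
        \<open>auto intro!: times_cont_diff_on_add[OF \<open>open S\<close>]\<close>)
qed (auto intro: continuous_on_scaleR)

text \<open>The derivative of an affine map is constant, so the directional derivatives of the composite are
  again composites of a directional derivative of \<open>f\<close> with the same affine map.\<close>

lemma times_cont_diff_on_compose_affine:
  assumes "open T" and L: "bounded_linear L"
  shows "times_cont_diff_on n S f \<Longrightarrow> (\<And>x. x \<in> T \<Longrightarrow> L x + a \<in> S) \<Longrightarrow>
    times_cont_diff_on n T (\<lambda>x. f (L x + a))"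
proof (induction n arbitrary: f)
  case 0
  have "continuous_on T (\<lambda>x. L x + a)"
    using L by (intro continuous_intros linear_continuous_on)
  then show ?case
    using 0 continuous_on_compose2[of S f T "\<lambda>x. L x + a"] by auto
next
  case (Suc n)
  have dL: "((\<lambda>x. L x + a) has_derivative L) (at x)" for x
    using bounded_linear_imp_has_derivative[OF L] by (auto intro!: derivative_eq_intros)
  show ?case
  proof (rule times_cont_diff_on_Suc_I[OF \<open>open T\<close>])
    show "((\<lambda>x. f (L x + a)) has_derivative (\<lambda>v. frechet_derivative f (at (L x + a)) (L v))) (at x)"
      if "x \<in> T" for x
      using has_derivative_compose[OF dL times_cont_diff_on_SucD[OF Suc.prems]] that by blast
    show "times_cont_diff_on n T (\<lambda>x. frechet_derivative f (at (L x + a)) (L v))" for v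
      using Suc by auto
  qed
qed

text \<open>The definition of \<open>C\<^sup>n\<close> controls the derivative in each fixed direction. Joint regularity in the
  point and the direction follows by expanding the direction in a basis, where the coordinates are
  bounded linear and the directional derivatives along basis vectors are \<open>C\<^sup>n\<close>.\<close>

lemma times_cont_diff_on_derivative_arg:
  fixes f :: "'e::real_normed_vector \<Rightarrow> 'b::real_normed_vector" and L :: "'v::real_normed_vector \<Rightarrow> 'e"
  assumes "open S" and f: "times_cont_diff_on (Suc n) S f"
    and dim: "finite B" "span B = (UNIV :: 'v set)" and L: "bounded_linear L"
  shows "times_cont_diff_on n (S \<times> UNIV) (\<lambda>(x, v). frechet_derivative f (at x) (L v))"
proof -
  obtain C where C: "C \<subseteq> B" "independent C" "B \<subseteq> span C"
    using real_vector.maximal_independent_subset by metis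
  have fin: "finite C" using C dim finite_subset by blast
  have spanC: "span C = UNIV"
    using C dim by (metis real_vector.span_mono real_vector.span_span top.extremum_uniqueI)
  have op: "open (S \<times> (UNIV :: 'v set))" using \<open>open S\<close> by (intro open_Times) auto
  have expand: "(\<Sum>b\<in>C. representation C v b *\<^sub>R frechet_derivative f (at x) (L b)) =
      frechet_derivative f (at x) (L v)" if "x \<in> S" for x v
  proof -
    have lin: "linear (\<lambda>v. frechet_derivative f (at x) (L v))"
      using times_cont_diff_on_SucD[OF f that] L
      by (metis bounded_linear_compose bounded_linear.linear has_derivative_bounded_linear)
    have "v = (\<Sum>b\<in>C. representation C v b *\<^sub>R b)"
      using real_vector.sum_representation_eq[OF C(2) _ fin order_refl] spanC by auto
    then have "frechet_derivative f (at x) (L v) =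
        (\<lambda>v. frechet_derivative f (at x) (L v)) (\<Sum>b\<in>C. representation C v b *\<^sub>R b)" by simp
    also have "\<dots> = (\<Sum>b\<in>C. representation C v b *\<^sub>R frechet_derivative f (at x) (L b))"
      unfolding linear_sum[OF lin] linear_scale[OF lin] ..
    finally show ?thesis by simp
  qed
  have "times_cont_diff_on n (S \<times> UNIV)
      (\<lambda>p. \<Sum>b\<in>C. representation C (snd p) b *\<^sub>R frechet_derivative f (at (fst p + 0)) (L b))"
  proof (intro times_cont_diff_on_sum[OF op] times_cont_diff_on_scaleR[OF op])
    show "times_cont_diff_on n (S \<times> UNIV) (\<lambda>p. representation C (snd p) b)" for b
      by (intro times_cont_diff_on_bounded_linear bounded_linear_compose[OF
            finite_dim_coordinate_bounded[OF fin C(2) spanC] bounded_linear_snd])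
    show "times_cont_diff_on n (S \<times> (UNIV :: 'v set)) (\<lambda>p. frechet_derivative f (at (fst p + 0)) (L b))" for b
      by (rule times_cont_diff_on_compose_affine[OF op bounded_linear_fst,
            where f = "\<lambda>x. frechet_derivative f (at x) (L b)"])
        (use f in auto)
  qed
  then show ?thesis
    by (rule times_cont_diff_on_cong[OF op, rotated]) (auto simp: expand)
qed

section \<open>Differentiable maps in charts\<close>

text \<open>The part of the manifold axioms that determines the topology. Product atlases, tangent spaces,
  tangent bundles and intervals satisfy it for elementary reasons, which is enough to speak about
  continuity and differentiability of maps into and out of them.\<close>

definition topological_atlas :: "('a, 'e::real_normed_vector) atlas \<Rightarrow> bool" where
  "topological_atlas A \<longleftrightarrow> (\<forall>c\<in>A. inj_on (snd c) (fst c)) \<and>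
     (\<forall>c\<in>A. \<forall>d\<in>A. open (snd c ` (fst c \<inter> fst d)))"

lemma topological_atlas_inj: "topological_atlas A \<Longrightarrow> c \<in> A \<Longrightarrow> inj_on (snd c) (fst c)"
  by (simp add: topological_atlas_def)

lemma topological_atlas_open: "topological_atlas A \<Longrightarrow> c \<in> A \<Longrightarrow> open (snd c ` fst c)"
  unfolding topological_atlas_def by (metis inf.idem)

lemma smooth_manifold_imp_topological_atlas: "smooth_manifold A \<Longrightarrow> topological_atlas A"
  by (simp add: smooth_manifold_def topological_atlas_def)

lemma in_pointsI: "c \<in> A \<Longrightarrow> p \<in> fst c \<Longrightarrow> p \<in> points A"
  by (auto simp: points_def)

lemma in_pointsE:
  assumes "p \<in> points A" obtains c where "c \<in> A" "p \<in> fst c"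
  using assms by (auto simp: points_def)

lemma openin_mtop_iff:
  assumes "topological_atlas A"
  shows "openin (mtop A) W \<longleftrightarrow> W \<subseteq> points A \<and> (\<forall>c\<in>A. open (snd c ` (W \<inter> fst c)))"
proof -
  let ?L = "\<lambda>W. W \<subseteq> points A \<and> (\<forall>c\<in>A. open (snd c ` (W \<inter> fst c)))"
  have "istopology ?L"
    unfolding istopology_def
  proof (intro conjI allI impI ballI)
    fix S T c assume "?L S" "?L T" "c \<in> A"
    moreover have "snd c ` ((S \<inter> T) \<inter> fst c) = snd c ` (S \<inter> fst c) \<inter> snd c ` (T \<inter> fst c)"
      using topological_atlas_inj[OF assms \<open>c \<in> A\<close>] by (auto simp: inj_on_def)
    ultimately show "open (snd c ` ((S \<inter> T) \<inter> fst c))" by auto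
  next
    fix \<K> c assume "\<forall>K\<in>\<K>. ?L K" "c \<in> A"
    moreover have "snd c ` (\<Union>\<K> \<inter> fst c) = (\<Union>K\<in>\<K>. snd c ` (K \<inter> fst c))" by blast
    ultimately show "open (snd c ` (\<Union>\<K> \<inter> fst c))" by auto
  qed blast+
  then show ?thesis by (simp add: mtop_def)
qed

lemma openin_chart_domain:
  assumes "topological_atlas A" "c \<in> A"
  shows "openin (mtop A) (fst c)"
  using assms unfolding openin_mtop_iff[OF assms(1)]
  by (auto simp: points_def topological_atlas_def Int_commute)

lemma topspace_mtop:
  assumes "topological_atlas A" shows "topspace (mtop A) = points A"
proof -
  have "openin (mtop A) (\<Union>c\<in>A. fst c)"
    using openin_chart_domain[OF assms] by blast
  then show ?thesis
    using openin_mtop_iff[OF assms] openin_subset openin_topspace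
    by (metis points_def subset_antisym)
qed

lemma coord_domain_open:
  assumes A: "topological_atlas A" and B: "topological_atlas B"
    and f: "continuous_map (mtop A) (mtop B) f" and c: "c \<in> A" and d: "d \<in> B"
  shows "open (snd c ` (fst c \<inter> f -` fst d))"
proof -
  have "openin (mtop A) {x \<in> topspace (mtop A). f x \<in> fst d}"
    using f openin_chart_domain[OF B d] by (rule openin_continuous_map_preimage)
  then have "open (snd c ` ({x \<in> points A. f x \<in> fst d} \<inter> fst c))"
    using c by (simp add: openin_mtop_iff[OF A] topspace_mtop[OF A])
  moreover have "{x \<in> points A. f x \<in> fst d} \<inter> fst c = fst c \<inter> f -` fst d"
    using c by (auto simp: points_def)
  ultimately show ?thesis by simp
qed

lemma inv_into_chart:
  "topological_atlas A \<Longrightarrow> c \<in> A \<Longrightarrow> p \<in> fst c \<Longrightarrow> inv_into (fst c) (snd c) (snd c p) = p"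
  by (simp add: topological_atlas_inj)

lemma coord_rep_apply:
  "topological_atlas A \<Longrightarrow> c \<in> A \<Longrightarrow> p \<in> fst c \<Longrightarrow> coord_rep c d f (snd c p) = snd d (f p)"
  by (simp add: coord_rep_def inv_into_chart)

text \<open>Continuity may be tested in charts once the coordinate domains are open: the preimage of an open
  set is the union of the preimages of its chart pieces.\<close>

lemma continuous_map_mtopI:
  assumes A: "topological_atlas A" and B: "topological_atlas B"
    and maps: "\<And>p. p \<in> points A \<Longrightarrow> f p \<in> points B"
    and op: "\<And>c d. c \<in> A \<Longrightarrow> d \<in> B \<Longrightarrow> open (snd c ` (fst c \<inter> f -` fst d))"
    and cont: "\<And>c d. c \<in> A \<Longrightarrow> d \<in> B \<Longrightarrow>
      continuous_on (snd c ` (fst c \<inter> f -` fst d)) (coord_rep c d f)"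
  shows "continuous_map (mtop A) (mtop B) f"
  unfolding continuous_map_def topspace_mtop[OF A] topspace_mtop[OF B]
proof (intro conjI allI impI)
  fix U assume "openin (mtop B) U"
  then have U: "U \<subseteq> points B" "\<And>d. d \<in> B \<Longrightarrow> open (snd d ` (U \<inter> fst d))"
    by (auto simp: openin_mtop_iff[OF B])
  have "open (snd c ` ({p \<in> points A. f p \<in> U} \<inter> fst c))" if c: "c \<in> A" for c
  proof -
    have "snd c ` ({p \<in> points A. f p \<in> U} \<inter> fst c) =
        (\<Union>d\<in>B. snd c ` (fst c \<inter> f -` fst d) \<inter> coord_rep c d f -` (snd d ` (U \<inter> fst d)))"
      (is "?L = ?R")
    proof (intro equalityI subsetI)
      fix x assume "x \<in> ?L"
      then obtain p where p: "p \<in> fst c" "f p \<in> U" "x = snd c p" by auto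
      then obtain d where "d \<in> B" "f p \<in> fst d" using U(1) by (auto simp: points_def)
      with p c show "x \<in> ?R" by (auto simp: coord_rep_apply[OF A] intro!: bexI[of _ d])
    next
      fix x assume "x \<in> ?R"
      then obtain d p where p: "d \<in> B" "p \<in> fst c" "f p \<in> fst d" "x = snd c p"
        "snd d (f p) \<in> snd d ` (U \<inter> fst d)"
        using c by (auto simp: coord_rep_apply[OF A])
      then have "f p \<in> U"
        using topological_atlas_inj[OF B \<open>d \<in> B\<close>] by (auto simp: inj_on_def)
      with p c show "x \<in> ?L" by (auto simp: points_def)
    qed
    moreover have "open \<dots>"
      using cont[OF c] op[OF c] U(2) by (intro open_UN ballI continuous_open_preimage) auto
    ultimately show ?thesis by simp
  qed
  then show "openin (mtop A) {p \<in> points A. f p \<in> U}"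
    by (auto simp: openin_mtop_iff[OF A])
qed (use maps in auto)

lemma continuous_map_mtop_points:
  "topological_atlas A \<Longrightarrow> topological_atlas B \<Longrightarrow> continuous_map (mtop A) (mtop B) f \<Longrightarrow>
   p \<in> points A \<Longrightarrow> f p \<in> points B"
  using continuous_map_image_subset_topspace[of "mtop A" "mtop B" f] by (auto simp: topspace_mtop)

lemma smooth_mapI:
  assumes A: "topological_atlas A" and B: "topological_atlas B"
    and maps: "\<And>p. p \<in> points A \<Longrightarrow> f p \<in> points B"
    and op: "\<And>c d. c \<in> A \<Longrightarrow> d \<in> B \<Longrightarrow> open (snd c ` (fst c \<inter> f -` fst d))"
    and smooth: "\<And>c d n. c \<in> A \<Longrightarrow> d \<in> B \<Longrightarrow>
      times_cont_diff_on n (snd c ` (fst c \<inter> f -` fst d)) (coord_rep c d f)"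
  shows "smooth_map A B f"
  unfolding smooth_map_def smooth_on_def
proof (intro conjI ballI allI)
  show "continuous_map (mtop A) (mtop B) f"
    using smooth[where n = 0] by (intro continuous_map_mtopI[OF A B maps op]) auto
qed (rule smooth)

text \<open>Smoothness is at issue for the projected right-hand side only; the other arguments are about first
  derivatives. Continuity is included because it makes the domains of coordinate representations open,
  without which derivatives in charts would not be determined.\<close>

definition differentiable_map ::
    "('a, 'e::real_normed_vector) atlas \<Rightarrow> ('b, 'f::real_normed_vector) atlas \<Rightarrow>
     ('a \<Rightarrow> 'b) \<Rightarrow> bool" where
  "differentiable_map A B f \<longleftrightarrow>
     topological_atlas A \<and> topological_atlas B \<and> continuous_map (mtop A) (mtop B) f \<and>
     (\<forall>c\<in>A. \<forall>d\<in>B. \<forall>p\<in>fst c. f p \<in> fst d \<longrightarrow> coord_rep c d f differentiable (at (snd c p)))"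

abbreviation chart_derivative ::
    "('a, 'e::real_normed_vector) chart \<Rightarrow> ('b, 'f::real_normed_vector) chart \<Rightarrow>
     ('a \<Rightarrow> 'b) \<Rightarrow> 'a \<Rightarrow> 'e \<Rightarrow> 'f" where
  "chart_derivative c d f p \<equiv> frechet_derivative (coord_rep c d f) (at (snd c p))"

lemma differentiable_map_has_derivative:
  assumes "differentiable_map A B f" "c \<in> A" "d \<in> B" "p \<in> fst c" "f p \<in> fst d"
  shows "(coord_rep c d f has_derivative chart_derivative c d f p) (at (snd c p))"
  using assms by (simp add: differentiable_map_def flip: frechet_derivative_works)

lemma differentiable_map_points:
  "differentiable_map A B f \<Longrightarrow> p \<in> points A \<Longrightarrow> f p \<in> points B"
  using continuous_map_mtop_points by (auto simp: differentiable_map_def)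

lemma differentiable_mapI:
  assumes A: "topological_atlas A" and B: "topological_atlas B"
    and maps: "\<And>p. p \<in> points A \<Longrightarrow> f p \<in> points B"
    and op: "\<And>c d. c \<in> A \<Longrightarrow> d \<in> B \<Longrightarrow> open (snd c ` (fst c \<inter> f -` fst d))"
    and diff: "\<And>c d p. c \<in> A \<Longrightarrow> d \<in> B \<Longrightarrow> p \<in> fst c \<Longrightarrow> f p \<in> fst d \<Longrightarrow>
      coord_rep c d f differentiable (at (snd c p))"
  shows "differentiable_map A B f"
  unfolding differentiable_map_def
proof (intro conjI ballI impI)
  show "continuous_map (mtop A) (mtop B) f"
    by (rule continuous_map_mtopI[OF A B maps op])
      (auto intro!: continuous_at_imp_continuous_on differentiable_imp_continuous_within diff)
qed (use A B diff in auto)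

lemma differentiable_map_domain_open:
  "differentiable_map A B f \<Longrightarrow> c \<in> A \<Longrightarrow> d \<in> B \<Longrightarrow> open (snd c ` (fst c \<inter> f -` fst d))"
  unfolding differentiable_map_def by (blast intro: coord_domain_open)

text \<open>The chain rule in charts: near the point, the representation of the composite is the composite
  of the representations through any chart \<open>d\<close> around the intermediate point.\<close>

lemma coord_rep_compose_has_derivative:
  assumes f: "differentiable_map A B f" and g: "differentiable_map B C g"
    and c: "c \<in> A" "p \<in> fst c" and d: "d \<in> B" "f p \<in> fst d" and e: "e \<in> C" "g (f p) \<in> fst e"
  shows "(coord_rep c e (\<lambda>q. g (f q)) has_derivative
    (\<lambda>v. chart_derivative d e g (f p) (chart_derivative c d f p v))) (at (snd c p))"
proof (rule has_derivative_transform_within_open)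
  have A: "topological_atlas A" and B: "topological_atlas B"
    using f by (auto simp: differentiable_map_def)
  show "open (snd c ` (fst c \<inter> f -` fst d))"
    using f c d by (intro differentiable_map_domain_open)
  show "snd c p \<in> snd c ` (fst c \<inter> f -` fst d)" using c d by auto
  show "coord_rep d e g (coord_rep c d f x) = coord_rep c e (\<lambda>q. g (f q)) x"
    if "x \<in> snd c ` (fst c \<inter> f -` fst d)" for x
    using that c d by (auto simp: coord_rep_apply[OF A] coord_rep_apply[OF B])
  have "(coord_rep d e g has_derivative chart_derivative d e g (f p)) (at (coord_rep c d f (snd c p)))"
    using differentiable_map_has_derivative[OF g d(1) e(1) d(2) e(2)] c
    by (simp add: coord_rep_apply[OF A])
  then show "((\<lambda>x. coord_rep d e g (coord_rep c d f x)) has_derivative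
      (\<lambda>v. chart_derivative d e g (f p) (chart_derivative c d f p v))) (at (snd c p))"
    by (rule has_derivative_compose[OF differentiable_map_has_derivative[OF f c(1) d(1) c(2) d(2)]])
qed

lemmas chart_derivative_compose =
  coord_rep_compose_has_derivative[THEN frechet_derivative_at, symmetric, THEN fun_cong]

lemma differentiable_map_compose:
  assumes f: "differentiable_map A B f" and g: "differentiable_map B C g"
  shows "differentiable_map A C (\<lambda>p. g (f p))"
  unfolding differentiable_map_def
proof (intro conjI ballI impI)
  show "continuous_map (mtop A) (mtop C) (\<lambda>p. g (f p))"
    using f g continuous_map_compose[of "mtop A" "mtop B" f "mtop C" g]
    by (auto simp: differentiable_map_def o_def)
next
  fix c e p assume *: "c \<in> A" "e \<in> C" "p \<in> fst c" "g (f p) \<in> fst e"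
  then obtain d where "d \<in> B" "f p \<in> fst d"
    using differentiable_map_points[OF f] in_pointsI in_pointsE by metis
  then show "coord_rep c e (\<lambda>q. g (f q)) differentiable (at (snd c p))"
    using coord_rep_compose_has_derivative[OF f g] * differentiableI by blast
qed (use f g in \<open>auto simp: differentiable_map_def\<close>)

lemma smooth_map_imp_differentiable_map:
  assumes "topological_atlas A" "topological_atlas B" "smooth_map A B f"
  shows "differentiable_map A B f"
  unfolding differentiable_map_def
proof (intro conjI ballI impI)
  fix c d p assume *: "c \<in> A" "d \<in> B" "p \<in> fst c" "f p \<in> fst d"
  then have "times_cont_diff_on (Suc 0) (snd c ` (fst c \<inter> f -` fst d)) (coord_rep c d f)"
    using assms(3) by (simp add: smooth_map_def smooth_on_def del: times_cont_diff_on.simps)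
  then show "coord_rep c d f differentiable (at (snd c p))"
    using * by auto
qed (use assms in \<open>auto simp: smooth_map_def\<close>)

text \<open>The identity is the map whose coordinate representations are the chart transitions. With it, the
  chain rule also yields the transformation laws of tangent vectors.\<close>

lemma differentiable_map_id:
  assumes "smooth_manifold A" shows "differentiable_map A A (\<lambda>p. p)"
proof (rule smooth_map_imp_differentiable_map)
  show "smooth_map A A (\<lambda>p. p)"
    using assms by (auto simp: smooth_map_def smooth_manifold_def vimage_def Int_def)
qed (use assms smooth_manifold_imp_topological_atlas in auto)

lemma chart_derivative_id:
  assumes A: "topological_atlas A" and "c \<in> A" "p \<in> fst c"
  shows "chart_derivative c c (\<lambda>q. q) p = (\<lambda>v. v)"
proof -
  have "(coord_rep c c (\<lambda>q. q) has_derivative (\<lambda>v. v)) (at (snd c p))"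
    by (rule has_derivative_transform_within_open[OF has_derivative_ident
          topological_atlas_open[OF A \<open>c \<in> A\<close>]])
      (use assms in \<open>auto simp: coord_rep_apply[OF A]\<close>)
  then show ?thesis by (rule frechet_derivative_at[symmetric])
qed

lemma differentiable_map_const:
  assumes "topological_atlas A" "topological_atlas B" "b \<in> points B"
  shows "differentiable_map A B (\<lambda>_. b)"
proof (rule differentiable_mapI)
  fix c d assume "c \<in> A" "d \<in> B"
  then show "open (snd c ` (fst c \<inter> (\<lambda>_. b) -` fst d))"
    using topological_atlas_open[OF assms(1)] by (cases "b \<in> fst d") auto
qed (use assms in \<open>auto simp: coord_rep_def\<close>)

lemma chart_derivative_const: "chart_derivative c d (\<lambda>_. b) p = (\<lambda>_. 0)"
  by (simp add: coord_rep_def)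

lemma chart_derivative_cong:
  assumes f: "differentiable_map A B f" and fg: "\<And>q. q \<in> points A \<Longrightarrow> f q = g q"
    and *: "c \<in> A" "d \<in> B" "p \<in> fst c" "f p \<in> fst d"
  shows "chart_derivative c d g p = chart_derivative c d f p"
proof (rule frechet_derivative_transform_within_open[symmetric])
  have A: "topological_atlas A" using f by (simp add: differentiable_map_def)
  show "open (snd c ` fst c)" using A \<open>c \<in> A\<close> by (rule topological_atlas_open)
  show "coord_rep c d f x = coord_rep c d g x" if "x \<in> snd c ` fst c" for x
  proof -
    from that obtain q where "q \<in> fst c" "x = snd c q" by blast
    then show ?thesis
      using fg[OF in_pointsI[OF \<open>c \<in> A\<close>]] \<open>c \<in> A\<close> by (simp add: coord_rep_apply[OF A])
  qed
  show "coord_rep c d f differentiable (at (snd c p))"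
    using f * unfolding differentiable_map_def by blast
qed (use * in blast)

subsection \<open>Products\<close>

definition prod_chart :: "('a, 'e) chart \<Rightarrow> ('b, 'f) chart \<Rightarrow> ('a \<times> 'b, 'e \<times> 'f) chart" where
  "prod_chart c d = (fst c \<times> fst d, map_prod (snd c) (snd d))"

lemma prod_chart_in_prod_atlas: "c \<in> A \<Longrightarrow> d \<in> B \<Longrightarrow> prod_chart c d \<in> prod_atlas A B"
  unfolding prod_atlas_def prod_chart_def by (rule image_eqI[of _ _ "(c, d)"]) auto

lemma in_prod_atlasE:
  assumes "C \<in> prod_atlas A B"
  obtains c d where "c \<in> A" "d \<in> B" "C = prod_chart c d"
  using assms unfolding prod_atlas_def prod_chart_def by clarsimp

lemma points_prod_atlas: "points (prod_atlas A B) = points A \<times> points B"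
proof (intro equalityI subsetI)
  fix z assume "z \<in> points A \<times> points B"
  then obtain c d where "c \<in> A" "d \<in> B" "z \<in> fst (prod_chart c d)"
    by (auto simp: points_def prod_chart_def)
  then show "z \<in> points (prod_atlas A B)"
    by (blast intro: in_pointsI prod_chart_in_prod_atlas)
qed (auto simp: points_def prod_chart_def elim!: in_prod_atlasE)

lemma topological_atlas_prod:
  assumes "topological_atlas A" "topological_atlas B"
  shows "topological_atlas (prod_atlas A B)"
  unfolding topological_atlas_def
proof (intro conjI ballI)
  fix C assume "C \<in> prod_atlas A B"
  then show "inj_on (snd C) (fst C)"
    using topological_atlas_inj[OF assms(1)] topological_atlas_inj[OF assms(2)]
    by (elim in_prod_atlasE) (simp add: prod_chart_def map_prod_inj_on)
next
  fix C D assume "C \<in> prod_atlas A B" "D \<in> prod_atlas A B"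
  then obtain c d c' d' where *: "c \<in> A" "d \<in> B" "C = prod_chart c d"
    "c' \<in> A" "d' \<in> B" "D = prod_chart c' d'"
    by (elim in_prod_atlasE)
  then have "snd C ` (fst C \<inter> fst D) = snd c ` (fst c \<inter> fst c') \<times> snd d ` (fst d \<inter> fst d')"
    by (simp add: prod_chart_def Times_Int_Times map_prod_image)
  then show "open (snd C ` (fst C \<inter> fst D))"
    using assms * by (auto simp: topological_atlas_def intro!: open_Times)
qed

lemma coord_rep_Pair:
  "coord_rep c (prod_chart d e) (\<lambda>p. (f p, g p)) = (\<lambda>x. (coord_rep c d f x, coord_rep c e g x))"
  by (simp add: coord_rep_def prod_chart_def)

lemma chart_derivative_Pair:
  assumes f: "differentiable_map A B f" and g: "differentiable_map A C g"
    and *: "c \<in> A" "d \<in> B" "e \<in> C" "p \<in> fst c" "f p \<in> fst d" "g p \<in> fst e"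
  shows "chart_derivative c (prod_chart d e) (\<lambda>q. (f q, g q)) p v =
    (chart_derivative c d f p v, chart_derivative c e g p v)"
  using has_derivative_Pair[OF differentiable_map_has_derivative[OF f *(1,2,4,5)]
      differentiable_map_has_derivative[OF g *(1,3,4,6)], THEN frechet_derivative_at, symmetric]
  by (simp add: coord_rep_Pair)

lemma differentiable_map_Pair:
  assumes f: "differentiable_map A B f" and g: "differentiable_map A C g"
  shows "differentiable_map A (prod_atlas B C) (\<lambda>p. (f p, g p))"
proof (rule differentiable_mapI)
  have A: "topological_atlas A" and B: "topological_atlas B" and C: "topological_atlas C"
    using f g by (auto simp: differentiable_map_def)
  then show "topological_atlas A" "topological_atlas (prod_atlas B C)"
    by (auto intro: topological_atlas_prod)
  show "(f p, g p) \<in> points (prod_atlas B C)" if "p \<in> points A" for p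
    using that f g by (simp add: points_prod_atlas differentiable_map_points)
  fix c D assume "c \<in> A" "D \<in> prod_atlas B C"
  then obtain d e where *: "c \<in> A" "d \<in> B" "e \<in> C" and D: "D = prod_chart d e"
    by (elim in_prod_atlasE)
  have "snd c ` (fst c \<inter> (\<lambda>p. (f p, g p)) -` fst D) =
      snd c ` (fst c \<inter> f -` fst d) \<inter> snd c ` (fst c \<inter> g -` fst e)"
    using topological_atlas_inj[OF A \<open>c \<in> A\<close>] by (auto simp: D prod_chart_def inj_on_def)
  then show "open (snd c ` (fst c \<inter> (\<lambda>p. (f p, g p)) -` fst D))"
    using * f g by (auto intro!: differentiable_map_domain_open)
  show "coord_rep c D (\<lambda>p. (f p, g p)) differentiable (at (snd c p))"
    if "p \<in> fst c" "(f p, g p) \<in> fst D" for p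
    using has_derivative_Pair[OF differentiable_map_has_derivative[OF f *(1,2)]
        differentiable_map_has_derivative[OF g *(1,3)], THEN differentiableI] that
    by (simp add: coord_rep_Pair D) (simp add: prod_chart_def)
qed

section \<open>Tangent maps and the tangent bundle\<close>

lemma tangent_space_transition:
  assumes "v \<in> tangent_space A p" "c \<in> A" "d \<in> A" "p \<in> fst c" "p \<in> fst d"
  shows "v d = chart_derivative c d (\<lambda>q. q) p (v c)"
  using assms unfolding tangent_space_def by blast

lemma tangent_space_outside:
  assumes "v \<in> tangent_space A p" "\<not> (c \<in> A \<and> p \<in> fst c)"
  shows "v c = 0"
  using assms unfolding tangent_space_def by blast

text \<open>The tangent map may be computed in any chart \<open>c\<close> around \<open>p\<close>: change from the selected chart to \<open>c\<close>
  with the chain rule applied to \<open>f\<close> after the identity.\<close>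

lemma tangent_map_apply:
  assumes A: "smooth_manifold A" and f: "differentiable_map A B f"
    and v: "v \<in> tangent_space A p" and c: "c \<in> A" "p \<in> fst c" and d: "d \<in> B" "f p \<in> fst d"
  shows "snd (tangent_map A B f (p, v)) d = chart_derivative c d f p (v c)"
proof -
  define c' where "c' = (SOME c. c \<in> A \<and> p \<in> fst c)"
  have c': "c' \<in> A" "p \<in> fst c'"
    using someI[of "\<lambda>c. c \<in> A \<and> p \<in> fst c" c] c unfolding c'_def by auto
  have "v c = chart_derivative c' c (\<lambda>q. q) p (v c')"
    using v c c' by (blast intro: tangent_space_transition)
  then have "chart_derivative c d f p (v c) = chart_derivative c' d f p (v c')"
    using chart_derivative_compose[OF differentiable_map_id[OF A] f c' c d] by simp
  then show ?thesis
    using d by (simp add: tangent_map_def c'_def Let_def)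
qed

lemma fst_tangent_map: "fst (tangent_map A B f (p, v)) = f p"
  by (simp add: tangent_map_def)

lemma snd_tangent_map_outside:
  "\<not> (d \<in> B \<and> f p \<in> fst d) \<Longrightarrow> snd (tangent_map A B f (p, v)) d = 0"
  by (auto simp: tangent_map_def)

text \<open>The compatibility between two charts of the target is the chain rule for the identity after \<open>f\<close>.\<close>

lemma tangent_map_in_tangent_space:
  assumes A: "smooth_manifold A" and B: "smooth_manifold B" and f: "differentiable_map A B f"
    and p: "p \<in> points A" and v: "v \<in> tangent_space A p"
  shows "snd (tangent_map A B f (p, v)) \<in> tangent_space B (f p)"
proof -
  obtain c where c: "c \<in> A" "p \<in> fst c" using p by (rule in_pointsE)
  show ?thesis
    unfolding tangent_space_def
  proof (intro CollectI conjI ballI impI allI)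
    fix d d' assume *: "d \<in> B" "d' \<in> B" "f p \<in> fst d \<and> f p \<in> fst d'"
    then have d: "f p \<in> fst d" "f p \<in> fst d'" by auto
    show "snd (tangent_map A B f (p, v)) d' =
        chart_derivative d d' (\<lambda>q. q) (f p) (snd (tangent_map A B f (p, v)) d)"
      unfolding tangent_map_apply[OF A f v c *(1) d(1)] tangent_map_apply[OF A f v c *(2) d(2)]
      by (rule chart_derivative_compose[OF f differentiable_map_id[OF B] c *(1) d(1) *(2) d(2)])
  qed (rule snd_tangent_map_outside)
qed

lemma tangent_map_eqI:
  assumes "f p = g q"
    and "\<And>d. d \<in> B \<Longrightarrow> f p \<in> fst d \<Longrightarrow>
      snd (tangent_map A B f (p, v)) d = snd (tangent_map C B g (q, w)) d"
  shows "tangent_map A B f (p, v) = tangent_map C B g (q, w)"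
proof (rule prod_eqI)
  show "snd (tangent_map A B f (p, v)) = snd (tangent_map C B g (q, w))"
    using assms by (metis snd_tangent_map_outside ext)
qed (use assms in \<open>simp add: fst_tangent_map\<close>)

lemma tangent_map_compose:
  assumes A: "smooth_manifold A" and B: "smooth_manifold B"
    and f: "differentiable_map A B f" and g: "differentiable_map B C g"
    and p: "p \<in> points A" and v: "v \<in> tangent_space A p"
  shows "tangent_map B C g (tangent_map A B f (p, v)) = tangent_map A C (\<lambda>q. g (f q)) (p, v)"
proof -
  obtain w where w: "tangent_map A B f (p, v) = (f p, w)"
    using fst_tangent_map prod.collapse by metis
  have wT: "w \<in> tangent_space B (f p)"
    using tangent_map_in_tangent_space[OF A B f p v] w by simp
  obtain c where c: "c \<in> A" "p \<in> fst c" using p by (rule in_pointsE)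
  obtain d where d: "d \<in> B" "f p \<in> fst d"
    using differentiable_map_points[OF f p] by (rule in_pointsE)
  have wd: "w d = chart_derivative c d f p (v c)"
    using tangent_map_apply[OF A f v c d] w by simp
  show ?thesis
    unfolding w
  proof (rule tangent_map_eqI)
    fix e assume e: "e \<in> C" "g (f p) \<in> fst e"
    show "snd (tangent_map B C g (f p, w)) e = snd (tangent_map A C (\<lambda>q. g (f q)) (p, v)) e"
      unfolding tangent_map_apply[OF B g wT d e] wd
        tangent_map_apply[OF A differentiable_map_compose[OF f g] v c e]
      by (rule chart_derivative_compose[OF f g c d e, symmetric])
  qed simp
qed

lemma tangent_map_cong:
  assumes A: "smooth_manifold A" and f: "differentiable_map A B f" and g: "differentiable_map A B g"
    and fg: "\<And>q. q \<in> points A \<Longrightarrow> f q = g q"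
    and p: "p \<in> points A" and v: "v \<in> tangent_space A p"
  shows "tangent_map A B f (p, v) = tangent_map A B g (p, v)"
proof (rule tangent_map_eqI)
  obtain c where c: "c \<in> A" "p \<in> fst c" using p by (rule in_pointsE)
  fix d assume d: "d \<in> B" "f p \<in> fst d"
  have d': "g p \<in> fst d" using d(2) fg[OF p] by simp
  have eq: "chart_derivative c d g p = chart_derivative c d f p"
    by (rule chart_derivative_cong[OF f _ c(1) d(1) c(2) d(2)]) (rule fg)
  show "snd (tangent_map A B f (p, v)) d = snd (tangent_map A B g (p, v)) d"
    unfolding tangent_map_apply[OF A f v c d] tangent_map_apply[OF A g v c d(1) d']
    by (simp only: eq)
qed (rule fg[OF p])

text \<open>Coordinates in one chart can be prescribed freely. The coordinates in the other charts around \<open>p\<close>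
  are then forced, and compatible by the chain rule for transition maps.\<close>

lemma tangent_vector_of_coordinates:
  assumes A: "smooth_manifold A" and c: "c \<in> A" "p \<in> fst c"
  obtains v where "v \<in> tangent_space A p" "v c = \<xi>"
proof -
  define v where "v = (\<lambda>d. if d \<in> A \<and> p \<in> fst d then chart_derivative c d (\<lambda>q. q) p \<xi> else 0)"
  have v: "v d = chart_derivative c d (\<lambda>q. q) p \<xi>" if "d \<in> A" "p \<in> fst d" for d
    using that by (simp add: v_def)
  have "v \<in> tangent_space A p"
    unfolding tangent_space_def
  proof (intro CollectI conjI ballI impI allI)
    fix d d' assume d: "d \<in> A" "d' \<in> A" "p \<in> fst d \<and> p \<in> fst d'"
    show "v d' = chart_derivative d d' (\<lambda>q. q) p (v d)"
      unfolding v[OF d(1) conjunct1[OF d(3)]] v[OF d(2) conjunct2[OF d(3)]]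
      by (rule chart_derivative_compose[OF differentiable_map_id[OF A] differentiable_map_id[OF A] c
          d(1) conjunct1[OF d(3)] d(2) conjunct2[OF d(3)]])
  next
    fix d assume "\<not> (d \<in> A \<and> p \<in> fst d)"
    then show "v d = 0" unfolding v_def by (rule if_not_P)
  qed
  moreover have "v c = \<xi>"
    unfolding v[OF c] chart_derivative_id[OF smooth_manifold_imp_topological_atlas[OF A] c] ..
  ultimately show ?thesis using that by blast
qed

lemma tangent_space_inj:
  assumes "c \<in> A" "p \<in> fst c"
  shows "inj_on (\<lambda>v. v c) (tangent_space A p)"
proof (rule inj_onI, rule ext)
  fix v w d assume *: "v \<in> tangent_space A p" "w \<in> tangent_space A p" "v c = w c"
  show "v d = w d"
  proof (cases "d \<in> A \<and> p \<in> fst d")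
    case True
    show ?thesis
      unfolding tangent_space_transition[OF *(1) assms(1) conjunct1[OF True] assms(2) conjunct2[OF True]]
        tangent_space_transition[OF *(2) assms(1) conjunct1[OF True] assms(2) conjunct2[OF True]] *(3)
      by (rule refl)
  next
    case False
    then show ?thesis
      using tangent_space_outside[OF *(1) False] tangent_space_outside[OF *(2) False] by simp
  qed
qed

lemma tangent_space_coordinates:
  assumes "smooth_manifold A" "c \<in> A" "p \<in> fst c"
  shows "(\<lambda>v. v c) ` tangent_space A p = UNIV"
proof (rule UNIV_eq_I[symmetric])
  fix \<xi> :: 'b
  obtain v where "v \<in> tangent_space A p" "v c = \<xi>"
    using tangent_vector_of_coordinates[OF assms] .
  then show "\<xi> \<in> (\<lambda>v. v c) ` tangent_space A p" by blast
qed

lemma points_tangent_space_atlas: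
  "p \<in> points A \<Longrightarrow> points (tangent_space_atlas A p) = tangent_space A p"
  by (auto simp: points_def tangent_space_atlas_def)

lemma topological_atlas_tangent_space:
  assumes "smooth_manifold A"
  shows "topological_atlas (tangent_space_atlas A p)"
  unfolding topological_atlas_def tangent_space_atlas_def
  by (clarsimp simp: tangent_space_inj tangent_space_coordinates[OF assms])

definition bundle_chart ::
    "('a, 'e::real_normed_vector) atlas \<Rightarrow> ('a, 'e) chart \<Rightarrow>
     ('a \<times> ('a, 'e) tangent_vec, 'e \<times> 'e) chart" where
  "bundle_chart A c = (Sigma (fst c) (tangent_space A), \<lambda>(p, v). (snd c p, v c))"

lemma tangent_bundle_atlas_eq: "tangent_bundle_atlas A = bundle_chart A ` A"
  by (simp add: tangent_bundle_atlas_def bundle_chart_def)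

lemma points_tangent_bundle: "points (tangent_bundle_atlas A) = Sigma (points A) (tangent_space A)"
  by (auto simp: points_def tangent_bundle_atlas_def)

lemma topological_atlas_tangent_bundle:
  assumes A: "smooth_manifold A"
  shows "topological_atlas (tangent_bundle_atlas A)"
  unfolding topological_atlas_def
proof (intro conjI ballI)
  have tA: "topological_atlas A" using A by (rule smooth_manifold_imp_topological_atlas)
  fix C assume "C \<in> tangent_bundle_atlas A"
  then obtain c where c: "c \<in> A" "C = bundle_chart A c" by (auto simp: tangent_bundle_atlas_eq)
  show "inj_on (snd C) (fst C)"
  proof (rule inj_onI, clarify)
    fix p v q w assume "(p, v) \<in> fst C" "(q, w) \<in> fst C" "snd C (p, v) = snd C (q, w)"
    then show "p = q \<and> v = w"
      using c topological_atlas_inj[OF tA c(1)] tangent_space_inj[OF c(1)]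
      by (auto simp: bundle_chart_def inj_on_def; blast)
  qed
  fix D assume "D \<in> tangent_bundle_atlas A"
  then obtain d where d: "d \<in> A" "D = bundle_chart A d" by (auto simp: tangent_bundle_atlas_eq)
  have "snd C ` (fst C \<inter> fst D) = (\<lambda>(p, v). (snd c p, v c)) ` Sigma (fst c \<inter> fst d) (tangent_space A)"
    unfolding c(2) d(2) bundle_chart_def by auto
  also have "\<dots> = snd c ` (fst c \<inter> fst d) \<times> UNIV"
  proof (intro equalityI subsetI)
    fix z assume "z \<in> snd c ` (fst c \<inter> fst d) \<times> (UNIV :: 'b set)"
    then obtain p \<xi> where p: "z = (snd c p, \<xi>)" "p \<in> fst c" "p \<in> fst d" by auto
    obtain v where "v \<in> tangent_space A p" "v c = \<xi>"
      using tangent_vector_of_coordinates[OF A c(1) p(2)] .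
    with p show "z \<in> (\<lambda>(p, v). (snd c p, v c)) ` Sigma (fst c \<inter> fst d) (tangent_space A)"
      by (force intro!: image_eqI[of _ _ "(p, v)"])
  qed auto
  finally show "open (snd C ` (fst C \<inter> fst D))"
    using tA c(1) d(1) by (auto simp: topological_atlas_def intro!: open_Times)
qed

section \<open>Curves\<close>

text \<open>An open interval with the identity as its only chart turns curves into differentiable maps between
  manifolds. The chart is a constant of its own so that the simplifier keeps \<open>snd (line_chart J) t\<close>
  and the chart derivatives in which it occurs intact.\<close>

definition line_chart :: "real set \<Rightarrow> (real, real) chart" where
  "line_chart J = (J, \<lambda>t. t)"

definition interval_atlas :: "real set \<Rightarrow> (real, real) atlas" where
  "interval_atlas J = {line_chart J}"

lemma line_chart_simps: "fst (line_chart J) = J" "snd (line_chart J) t = t"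
  by (simp_all add: line_chart_def)

lemma line_chart_in_interval_atlas: "line_chart J \<in> interval_atlas J"
  by (simp add: interval_atlas_def)

lemma points_interval_atlas: "points (interval_atlas J) = J"
  by (simp add: points_def interval_atlas_def line_chart_simps)

lemma topological_atlas_interval: "open J \<Longrightarrow> topological_atlas (interval_atlas J)"
  by (simp add: topological_atlas_def interval_atlas_def line_chart_def)

lemma mtop_interval_atlas:
  assumes "open J" shows "mtop (interval_atlas J) = top_of_set J"
  unfolding topology_eq openin_mtop_iff[OF topological_atlas_interval[OF assms]]
    openin_open_eq[OF assms] points_interval_atlas
  by (auto simp: interval_atlas_def line_chart_def Int_absorb2)

lemma linear_real_line:
  fixes f :: "real \<Rightarrow> 'a::real_vector"
  assumes "linear f" shows "f = (\<lambda>h. h *\<^sub>R f 1)"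
proof
  show "f h = h *\<^sub>R f 1" for h
    using linear_scale[OF assms, of h 1] by (simp only: real_scaleR_def mult_1_right)
qed

abbreviation velocity_coords ::
    "real set \<Rightarrow> ('a, 'e::real_normed_vector) chart \<Rightarrow> (real \<Rightarrow> 'a) \<Rightarrow> real \<Rightarrow> 'e" where
  "velocity_coords J c \<gamma> t \<equiv> chart_derivative (line_chart J) c \<gamma> t 1"

lemma curve_has_vector_derivative_iff:
  assumes J: "open J" "t \<in> J"
  shows "((\<lambda>s. snd c (\<gamma> s)) has_vector_derivative w) (at t) \<longleftrightarrow>
    (coord_rep (line_chart J) c \<gamma> has_derivative (\<lambda>h. h *\<^sub>R w)) (at (snd (line_chart J) t))"
proof -
  have eq: "coord_rep (line_chart J) c \<gamma> x = snd c (\<gamma> x)" if "x \<in> J" for x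
    using coord_rep_apply[OF topological_atlas_interval[OF \<open>open J\<close>] line_chart_in_interval_atlas, of x c \<gamma>]
      that by (simp add: line_chart_simps)
  show ?thesis
    unfolding has_vector_derivative_def line_chart_simps
    by (rule iffI; erule has_derivative_transform_within_open[OF _ J]) (simp_all add: eq)
qed

text \<open>Solutions as differentiable maps: in every chart, the prescribed vector is the derivative of
  the coordinate representation applied to the unit vector 1 of the real line.\<close>

lemma solution_iff:
  assumes N: "topological_atlas N" and J: "open J"
  shows "solution N f u J \<gamma> \<longleftrightarrow>
    differentiable_map (interval_atlas J) N \<gamma> \<and>
    (\<forall>t\<in>J. fst (f (\<gamma> t, u t)) = \<gamma> t \<and>
       (\<forall>c\<in>N. \<gamma> t \<in> fst c \<longrightarrow> snd (f (\<gamma> t, u t)) c = velocity_coords J c \<gamma> t))"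
    (is "?L \<longleftrightarrow> ?R")
proof
  assume L: ?L
  have D: "(coord_rep (line_chart J) c \<gamma> has_derivative (\<lambda>h. h *\<^sub>R snd (f (\<gamma> t, u t)) c))
      (at (snd (line_chart J) t))" if "t \<in> J" "c \<in> N" "\<gamma> t \<in> fst c" for t c
    using L that curve_has_vector_derivative_iff[OF J]
    unfolding solution_def has_velocity_def by blast
  have "continuous_map (top_of_set J) (mtop N) \<gamma>"
    using L unfolding solution_def by blast
  then have "differentiable_map (interval_atlas J) N \<gamma>"
    using N topological_atlas_interval[OF J] D
    unfolding differentiable_map_def mtop_interval_atlas[OF J]
    by (auto simp: interval_atlas_def line_chart_simps differentiable_def)
  moreover have "snd (f (\<gamma> t, u t)) c = velocity_coords J c \<gamma> t"
    if "t \<in> J" "c \<in> N" "\<gamma> t \<in> fst c" for t c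
    using frechet_derivative_at[OF D[OF that], THEN fun_cong, of 1] by simp
  moreover have "fst (f (\<gamma> t, u t)) = \<gamma> t" if "t \<in> J" for t
    using L that unfolding solution_def has_velocity_def by blast
  ultimately show ?R by blast
next
  assume R: ?R
  then have \<gamma>: "differentiable_map (interval_atlas J) N \<gamma>" by blast
  have "((\<lambda>s. snd c (\<gamma> s)) has_vector_derivative snd (f (\<gamma> t, u t)) c) (at t)"
    if *: "t \<in> J" "c \<in> N" "\<gamma> t \<in> fst c" for t c
  proof -
    have t: "t \<in> fst (line_chart J)" using * by (simp add: line_chart_simps)
    have D: "(coord_rep (line_chart J) c \<gamma> has_derivative chart_derivative (line_chart J) c \<gamma> t)
        (at (snd (line_chart J) t))"
      using differentiable_map_has_derivative[OF \<gamma> line_chart_in_interval_atlas *(2) t *(3)] .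
    have "snd (f (\<gamma> t, u t)) c = velocity_coords J c \<gamma> t"
      using R * by blast
    then show ?thesis
      unfolding curve_has_vector_derivative_iff[OF J *(1)]
      using has_derivative_eq_rhs[OF D linear_real_line[OF has_derivative_linear[OF D]]]
      by (simp only:)
  qed
  moreover have "continuous_map (top_of_set J) (mtop N) \<gamma>"
    using \<gamma> unfolding differentiable_map_def mtop_interval_atlas[OF J] by blast
  ultimately show ?L
    using R unfolding solution_def has_velocity_def by blast
qed

lemma velocity_coords_compose:
  assumes "differentiable_map (interval_atlas J) A \<gamma>" "differentiable_map A B f"
    and "t \<in> J" "c \<in> A" "\<gamma> t \<in> fst c" "d \<in> B" "f (\<gamma> t) \<in> fst d"
  shows "velocity_coords J d (\<lambda>s. f (\<gamma> s)) t = chart_derivative c d f (\<gamma> t) (velocity_coords J c \<gamma> t)"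
  using assms(3)
  by (intro chart_derivative_compose[OF assms(1,2) line_chart_in_interval_atlas _ assms(4-7)])
    (simp add: line_chart_simps)

text \<open>Within a chart, a curve with derivative zero is constant, so \<open>z\<close> is locally constant, and the
  interval is connected.\<close>

lemma zero_velocity_imp_constant:
  assumes J: "open J" "connected J" and z: "differentiable_map (interval_atlas J) N z"
    and zero: "\<And>t c. t \<in> J \<Longrightarrow> c \<in> N \<Longrightarrow> z t \<in> fst c \<Longrightarrow> velocity_coords J c z t = 0"
  shows "z constant_on J"
proof (rule locally_constant_imp_constant[OF J(2)])
  fix t assume t: "t \<in> J"
  have N: "topological_atlas N" using z by (simp add: differentiable_map_def)
  have "z t \<in> points N"
    using differentiable_map_points[OF z] t by (simp add: points_interval_atlas)
  then obtain c where c: "c \<in> N" "z t \<in> fst c" by (rule in_pointsE)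
  have "open (snd (line_chart J) ` (fst (line_chart J) \<inter> z -` fst c))"
    using z line_chart_in_interval_atlas c(1) by (rule differentiable_map_domain_open)
  then have "open (J \<inter> z -` fst c)" by (simp add: line_chart_simps)
  then obtain e where e: "e > 0" "ball t e \<subseteq> J \<inter> z -` fst c"
    using t c(2) openE by blast
  have D: "(coord_rep (line_chart J) c z has_derivative (\<lambda>h. 0)) (at s within ball t e)"
    if "s \<in> ball t e" for s
  proof -
    have s: "s \<in> J" "s \<in> fst (line_chart J)" "z s \<in> fst c"
      using e that by (auto simp: line_chart_simps)
    have D: "(coord_rep (line_chart J) c z has_derivative chart_derivative (line_chart J) c z s)
        (at (snd (line_chart J) s))"
      using differentiable_map_has_derivative[OF z line_chart_in_interval_atlas c(1) s(2,3)] .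
    have "chart_derivative (line_chart J) c z s = (\<lambda>h. 0)"
      by (subst linear_real_line[OF has_derivative_linear[OF D]])
        (simp add: zero[OF s(1) c(1) s(3)])
    with D show ?thesis
      using has_derivative_at_withinI unfolding line_chart_simps by metis
  qed
  obtain k where k: "\<And>s. s \<in> ball t e \<Longrightarrow> coord_rep (line_chart J) c z s = k"
    using has_derivative_zero_constant[OF convex_ball D] by blast
  have "z s = z t" if "s \<in> ball t e" for s
  proof -
    have "coord_rep (line_chart J) c z r = snd c (z r)" if "r \<in> ball t e" for r
      using coord_rep_apply[OF topological_atlas_interval[OF J(1)] line_chart_in_interval_atlas, of r c z]
        that e by (auto simp: line_chart_simps)
    then have "snd c (z s) = snd c (z t)" using k that e(1) by (metis centre_in_ball)
    then show ?thesis
      using topological_atlas_inj[OF N c(1)] that e c(2) by (auto simp: inj_on_def)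
  qed
  moreover have "openin (top_of_set J) (ball t e)"
    using e J by (auto simp: openin_open_eq)
  ultimately show "\<exists>T. openin (top_of_set J) T \<and> t \<in> T \<and> (\<forall>x\<in>T. z x = z t)"
    using e(1) centre_in_ball by blast
qed

section \<open>The infinitesimal action\<close>

locale smooth_transitive_right_action =
  fixes G :: "('g, 'z) monoid_scheme"
    and A :: "('g, 'e::real_normed_vector) atlas"
    and M :: "('m, 'f::real_normed_vector) atlas"
    and h :: "'g \<Rightarrow> 'm \<Rightarrow> 'm"
  assumes lie: "lie_group G A" and manifold_M: "smooth_manifold M"
    and smooth_action: "smooth_map (prod_atlas A M) M (\<lambda>(X, y). h X y)"
    and action: "right_action G (points M) h" and transitive: "transitive_action G (points M) h"
begin

text \<open>The fundamental vector fields of the action. They turn out to be the projected right-hand side, but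
  involve no choice of a point in a fibre and do not mention \<open>y0\<close>.\<close>

definition infinitesimal_action ::
    "'m \<times> ('g, 'e) tangent_vec \<Rightarrow> 'm \<times> ('m, 'f) tangent_vec" where
  "infinitesimal_action = (\<lambda>(y, u). tangent_map A M (\<lambda>X. h X y) (\<one>\<^bsub>G\<^esub>, u))"

lemma manifold_G: "smooth_manifold A" and carrier_G: "carrier G = points A"
  and group_G: "group G"
  using lie by (auto simp: lie_group_def)

interpretation group G by (rule group_G)

lemmas atlas_G = smooth_manifold_imp_topological_atlas[OF manifold_G]
lemmas atlas_M = smooth_manifold_imp_topological_atlas[OF manifold_M]

lemma act_closed: "X \<in> points A \<Longrightarrow> y \<in> points M \<Longrightarrow> h X y \<in> points M"
  using action by (simp add: right_action_def carrier_G)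

lemma act_act: "X \<in> points A \<Longrightarrow> Y \<in> points A \<Longrightarrow> y \<in> points M \<Longrightarrow> h X (h Y y) = h (Y \<otimes>\<^bsub>G\<^esub> X) y"
  using action by (simp add: right_action_def carrier_G)

lemma one_in: "\<one>\<^bsub>G\<^esub> \<in> points A" and inv_in: "X \<in> points A \<Longrightarrow> inv\<^bsub>G\<^esub> X \<in> points A"
  by (simp_all flip: carrier_G)

text \<open>The unit law follows from transitivity: every \<open>y\<close> is of the form \<open>h X y\<close>, and \<open>\<one>\<close> acts trivially
  on points of the form \<open>h X y\<close>.\<close>

lemma act_one:
  assumes "y \<in> points M" shows "h \<one>\<^bsub>G\<^esub> y = y"
proof -
  obtain X where X: "X \<in> points A" "h X y = y"
    using transitive assms by (auto simp: transitive_action_def carrier_G)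
  then have "h \<one>\<^bsub>G\<^esub> (h X y) = h X y"
    using assms one_in carrier_G by (subst act_act) auto
  then show ?thesis using X by simp
qed

lemma act_inv:
  assumes "X \<in> points A" "y \<in> points M"
  shows "h X (h (inv\<^bsub>G\<^esub> X) y) = y" "h (inv\<^bsub>G\<^esub> X) (h X y) = y"
  using assms act_act[of X "inv\<^bsub>G\<^esub> X" y] act_act[of "inv\<^bsub>G\<^esub> X" X y] inv_in act_one carrier_G
  by auto

lemma differentiable_act: "differentiable_map (prod_atlas A M) M (\<lambda>(X, y). h X y)"
  using smooth_action by (intro smooth_map_imp_differentiable_map topological_atlas_prod atlas_G atlas_M)

lemma differentiable_orbit_map: "y \<in> points M \<Longrightarrow> differentiable_map A M (\<lambda>X. h X y)"
  using differentiable_map_compose[OF differentiable_map_Pair[OF differentiable_map_id[OF manifold_G]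
        differentiable_map_const[OF atlas_G atlas_M]] differentiable_act]
  by simp

lemma differentiable_left_mult:
  assumes "X \<in> points A" shows "differentiable_map A A (\<lambda>Y. X \<otimes>\<^bsub>G\<^esub> Y)"
proof -
  have "differentiable_map (prod_atlas A A) A (\<lambda>(X, Y). X \<otimes>\<^bsub>G\<^esub> Y)"
    using lie by (intro smooth_map_imp_differentiable_map topological_atlas_prod atlas_G)
      (auto simp: lie_group_def)
  from differentiable_map_compose[OF differentiable_map_Pair[OF
        differentiable_map_const[OF atlas_G atlas_G assms] differentiable_map_id[OF manifold_G]] this]
  show ?thesis by simp
qed

lemma differentiable_inv: "differentiable_map A A (\<lambda>X. inv\<^bsub>G\<^esub> X)"
  using lie by (intro smooth_map_imp_differentiable_map atlas_G) (auto simp: lie_group_def)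

lemma left_invariant_rhs_tangent:
  assumes "X \<in> points A" "u \<in> tangent_space A \<one>\<^bsub>G\<^esub>"
  obtains w where "left_invariant_rhs G A (X, u) = (X, w)" "w \<in> tangent_space A X"
proof
  show "left_invariant_rhs G A (X, u) = (X, snd (left_invariant_rhs G A (X, u)))"
    using assms by (intro prod_eqI)
      (auto simp: left_invariant_rhs_def fst_tangent_map simp flip: carrier_G)
  show "snd (left_invariant_rhs G A (X, u)) \<in> tangent_space A X"
    using tangent_map_in_tangent_space[OF manifold_G manifold_G
        differentiable_left_mult[OF assms(1)] one_in assms(2)]
      assms(1) by (simp add: left_invariant_rhs_def flip: carrier_G)
qed

text \<open>The heart of the projection property: the orbit map of \<open>y\<close> after left multiplication by \<open>X\<close> is the orbit
  map of \<open>h X y\<close>, by the law of a right action.\<close>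

lemma orbit_map_left_invariant:
  assumes X: "X \<in> points A" and y: "y \<in> points M" and u: "u \<in> tangent_space A \<one>\<^bsub>G\<^esub>"
  shows "tangent_map A M (\<lambda>X. h X y) (left_invariant_rhs G A (X, u)) =
    infinitesimal_action (h X y, u)"
proof -
  have "tangent_map A M (\<lambda>X. h X y) (left_invariant_rhs G A (X, u)) =
      tangent_map A M (\<lambda>Y. h (X \<otimes>\<^bsub>G\<^esub> Y) y) (\<one>\<^bsub>G\<^esub>, u)"
    using tangent_map_compose[OF manifold_G manifold_G differentiable_left_mult[OF X]
        differentiable_orbit_map[OF y]
        one_in u]
    by (simp add: left_invariant_rhs_def)
  also have "\<dots> = tangent_map A M (\<lambda>Y. h Y (h X y)) (\<one>\<^bsub>G\<^esub>, u)"
    by (rule tangent_map_cong[OF manifold_G differentiable_map_compose[OF differentiable_left_mult[OF X]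
            differentiable_orbit_map[OF y]] differentiable_orbit_map[OF act_closed[OF X y]] _ one_in u])
      (simp add: act_act X y)
  finally show ?thesis by (simp add: infinitesimal_action_def)
qed

lemma fst_infinitesimal_action: "y \<in> points M \<Longrightarrow> fst (infinitesimal_action (y, u)) = y"
  by (simp add: infinitesimal_action_def fst_tangent_map act_one)

lemma infinitesimal_action_tangent:
  assumes "y \<in> points M" "u \<in> tangent_space A \<one>\<^bsub>G\<^esub>"
  obtains w where "infinitesimal_action (y, u) = (y, w)" "w \<in> tangent_space M y"
proof
  show "infinitesimal_action (y, u) = (y, snd (infinitesimal_action (y, u)))"
    using fst_infinitesimal_action[OF assms(1)] by (metis prod.collapse)
  show "snd (infinitesimal_action (y, u)) \<in> tangent_space M y"
    using tangent_map_in_tangent_space[OF manifold_G manifold_M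
        differentiable_orbit_map[OF assms(1)] one_in assms(2)]
    by (simp add: infinitesimal_action_def act_one[OF assms(1)])
qed

text \<open>The orbit map of \<open>y\<close> is \<open>h\<close> after \<open>X \<mapsto> (X, y)\<close>, whose derivative is \<open>\<xi> \<mapsto> (\<xi>, 0)\<close>. This writes the
  infinitesimal action with the derivative of a single smooth map, in which \<open>y\<close> is an argument.\<close>

lemma infinitesimal_action_coords:
  assumes y: "y \<in> points M" and u: "u \<in> tangent_space A \<one>\<^bsub>G\<^esub>"
    and c: "c \<in> A" "\<one>\<^bsub>G\<^esub> \<in> fst c" and d': "d' \<in> M" "y \<in> fst d'" and d: "d \<in> M" "y \<in> fst d"
  shows "snd (infinitesimal_action (y, u)) d =
    chart_derivative (prod_chart c d') d (\<lambda>(X, y). h X y) (\<one>\<^bsub>G\<^esub>, y) (u c, 0)"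
proof -
  have hd: "h \<one>\<^bsub>G\<^esub> y \<in> fst d" using d act_one[OF y] by simp
  have "snd (infinitesimal_action (y, u)) d = chart_derivative c d (\<lambda>X. h X y) \<one>\<^bsub>G\<^esub> (u c)"
    unfolding infinitesimal_action_def prod.case
    by (rule tangent_map_apply[OF manifold_G differentiable_orbit_map[OF y] u c d(1) hd])
  also have "\<dots> = chart_derivative (prod_chart c d') d (\<lambda>(X, y). h X y) (\<one>\<^bsub>G\<^esub>, y)
      (chart_derivative c (prod_chart c d') (\<lambda>X. (X, y)) \<one>\<^bsub>G\<^esub> (u c))"
    using chart_derivative_compose[OF differentiable_map_Pair[OF differentiable_map_id[OF manifold_G]
        differentiable_map_const[OF atlas_G atlas_M y]] differentiable_act c
        prod_chart_in_prod_atlas[OF c(1) d'(1)] _ d(1), of "u c"] c d' hd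
    by (simp add: prod_chart_def)
  also have "chart_derivative c (prod_chart c d') (\<lambda>X. (X, y)) \<one>\<^bsub>G\<^esub> (u c) = (u c, 0)"
    by (subst chart_derivative_Pair[OF differentiable_map_id[OF manifold_G]
          differentiable_map_const[OF atlas_G atlas_M y] c(1) c(1) d'(1) c(2) c(2) d'(2)])
      (simp only: chart_derivative_id[OF atlas_G c] chart_derivative_const)
  finally show ?thesis .
qed

text \<open>In coordinates, the map is \<open>(x, \<xi>) \<mapsto> (\<tau> x, DH(a, x) (\<xi>, 0))\<close> with \<open>\<tau>\<close> a transition map of \<open>M\<close>, \<open>H\<close>
  the coordinate representation of the action and \<open>a\<close> the coordinates of the unit. The lemma is
  stated for any \<open>F\<close> that agrees with the infinitesimal action on the manifold, because the
  projected right-hand side is such a map and may differ from it off the manifold.\<close>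

lemma smooth_infinitesimal_action:
  assumes F: "\<And>y u. y \<in> points M \<Longrightarrow> u \<in> tangent_space A \<one>\<^bsub>G\<^esub> \<Longrightarrow>
    F (y, u) = infinitesimal_action (y, u)"
  shows "smooth_map (prod_atlas M (tangent_space_atlas A \<one>\<^bsub>G\<^esub>)) (tangent_bundle_atlas M) F"
proof (rule smooth_mapI)
  let ?T = "tangent_space A \<one>\<^bsub>G\<^esub>"
  show "topological_atlas (prod_atlas M (tangent_space_atlas A \<one>\<^bsub>G\<^esub>))"
    by (intro topological_atlas_prod atlas_M topological_atlas_tangent_space manifold_G)
  show "topological_atlas (tangent_bundle_atlas M)"
    using manifold_M by (rule topological_atlas_tangent_bundle)
  show "F p \<in> points (tangent_bundle_atlas M)"
    if p: "p \<in> points (prod_atlas M (tangent_space_atlas A \<one>\<^bsub>G\<^esub>))" for p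
  proof -
    obtain y u where yu: "p = (y, u)" "y \<in> points M" "u \<in> ?T"
      using p by (cases p) (auto simp: points_prod_atlas points_tangent_space_atlas one_in)
    obtain w where "infinitesimal_action (y, u) = (y, w)" "w \<in> tangent_space M y"
      using infinitesimal_action_tangent[OF yu(2,3)] .
    then show ?thesis
      using F[OF yu(2,3)] yu by (simp add: points_tangent_bundle)
  qed
  fix C D n assume "C \<in> prod_atlas M (tangent_space_atlas A \<one>\<^bsub>G\<^esub>)" "D \<in> tangent_bundle_atlas M"
  then obtain d' c d where d': "d' \<in> M" and c: "c \<in> A" "\<one>\<^bsub>G\<^esub> \<in> fst c" and d: "d \<in> M"
    and C: "C = prod_chart d' (?T, \<lambda>v. v c)" and D: "D = bundle_chart M d"
    by (auto simp: tangent_bundle_atlas_eq tangent_space_atlas_def elim!: in_prod_atlasE)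
  let ?S = "snd d' ` (fst d' \<inter> fst d)"
  have "fst C \<inter> F -` fst D = (fst d' \<inter> fst d) \<times> ?T"
  proof -
    have "F (y, u) \<in> fst D \<longleftrightarrow> y \<in> fst d" if yu: "y \<in> fst d'" "u \<in> ?T" for y u
    proof -
      have y: "y \<in> points M" using yu d' in_pointsI by metis
      obtain w where "infinitesimal_action (y, u) = (y, w)" "w \<in> tangent_space M y"
        using infinitesimal_action_tangent[OF y yu(2)] .
      then show ?thesis using F[OF y yu(2)] by (simp add: D bundle_chart_def)
    qed
    then have "p \<in> fst C \<inter> F -` fst D \<longleftrightarrow> p \<in> (fst d' \<inter> fst d) \<times> ?T" for p
      by (cases p) (simp add: C prod_chart_def, blast)
    then show ?thesis by blast
  qed
  then have dom: "snd C ` (fst C \<inter> F -` fst D) = ?S \<times> UNIV"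
    using tangent_space_coordinates[OF manifold_G c] by (simp add: C prod_chart_def map_prod_image)
  have "open ?S"
    using atlas_M d' d by (simp add: topological_atlas_def)
  then have op: "open (?S \<times> (UNIV :: 'e set))" by (intro open_Times) auto
  then show "open (snd C ` (fst C \<inter> F -` fst D))" unfolding dom .
  define H where "H = coord_rep (prod_chart c d') d (\<lambda>(X, y). h X y)"
  define R where "R = snd (prod_chart c d') ` (fst (prod_chart c d') \<inter> (\<lambda>(X, y). h X y) -` fst d)"
  have "open R"
    unfolding R_def
    by (rule differentiable_map_domain_open[OF differentiable_act prod_chart_in_prod_atlas[OF c(1) d'] d])
  have H: "times_cont_diff_on (Suc n) R H"
    using smooth_action prod_chart_in_prod_atlas[OF c(1) d'] d
    unfolding smooth_map_def smooth_on_def R_def H_def by blast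
  have in_R: "(snd c \<one>\<^bsub>G\<^esub>, x) \<in> R" if x: "x \<in> ?S" for x
  proof -
    obtain y where y: "x = snd d' y" "y \<in> fst d'" "y \<in> fst d" using x by auto
    then have "h \<one>\<^bsub>G\<^esub> y = y" using act_one in_pointsI[OF d] by metis
    with y c show ?thesis
      unfolding R_def prod_chart_def by (intro image_eqI[of _ _ "(\<one>\<^bsub>G\<^esub>, y)"]) auto
  qed
  obtain B :: "'e set" where B: "finite B" "span B = UNIV"
    using manifold_G unfolding smooth_manifold_def by blast
  have "times_cont_diff_on n (R \<times> UNIV) (\<lambda>(p, \<xi>). frechet_derivative H (at p) (\<xi>, 0))"
    by (rule times_cont_diff_on_derivative_arg[OF \<open>open R\<close> H B])
      (intro bounded_linear_Pair bounded_linear_ident bounded_linear_zero)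
  \<comment> \<open>Insert the coordinates \<open>a\<close> of the unit by the affine map \<open>(x, \<xi>) \<mapsto> ((a, x), \<xi>)\<close>.\<close>
  then have "times_cont_diff_on n (?S \<times> UNIV)
      (\<lambda>p. (\<lambda>(p, \<xi>). frechet_derivative H (at p) (\<xi>, 0)) (((0, fst p), snd p) + ((snd c \<one>\<^bsub>G\<^esub>, 0), 0)))"
    by (rule times_cont_diff_on_compose_affine[OF op, rotated])
      (auto simp: in_R intro!: bounded_linear_Pair bounded_linear_fst bounded_linear_snd bounded_linear_zero)
  moreover have "times_cont_diff_on n (?S \<times> (UNIV :: 'e set)) (\<lambda>p. coord_rep d' d (\<lambda>q. q) (fst p + 0))"
    by (rule times_cont_diff_on_compose_affine[OF op bounded_linear_fst, of _ ?S])
      (use manifold_M d' d in \<open>auto simp: smooth_manifold_def smooth_on_def\<close>)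
  ultimately have smooth_coords: "times_cont_diff_on n (?S \<times> UNIV)
      (\<lambda>p. (coord_rep d' d (\<lambda>q. q) (fst p), frechet_derivative H (at (snd c \<one>\<^bsub>G\<^esub>, fst p)) (snd p, 0)))"
    using times_cont_diff_on_Pair[OF op] by simp
  show "times_cont_diff_on n (snd C ` (fst C \<inter> F -` fst D)) (coord_rep C D F)"
    unfolding dom
  proof (rule times_cont_diff_on_cong[OF op _ smooth_coords])
    fix p assume "p \<in> ?S \<times> (UNIV :: 'e set)"
    then obtain y \<xi> where p: "p = (snd d' y, \<xi>)" and y: "y \<in> fst d'" "y \<in> fst d" by auto
    obtain u where u: "u \<in> ?T" "u c = \<xi>" using tangent_vector_of_coordinates[OF manifold_G c] .
    have yM: "y \<in> points M" using d y in_pointsI by metis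
    obtain w where w: "infinitesimal_action (y, u) = (y, w)" and "w \<in> tangent_space M y"
      using infinitesimal_action_tangent[OF yM u(1)] .
    have rep: "coord_rep C D F p = snd D (F (y, u))"
    proof -
      have "C \<in> prod_atlas M (tangent_space_atlas A \<one>\<^bsub>G\<^esub>)"
        unfolding C using d' c by (intro prod_chart_in_prod_atlas) (auto simp: tangent_space_atlas_def)
      moreover have "(y, u) \<in> fst C" using u y by (simp add: C prod_chart_def)
      moreover have pC: "p = snd C (y, u)" using p u by (simp add: C prod_chart_def)
      ultimately show ?thesis
        unfolding pC
        by (intro coord_rep_apply[OF topological_atlas_prod[OF atlas_M
                topological_atlas_tangent_space[OF manifold_G]]])
    qed
    have "snd D (F (y, u)) = (snd d y, w d)"
      by (simp add: F[OF yM u(1)] w D bundle_chart_def)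
    also have "w d = frechet_derivative H (at (snd c \<one>\<^bsub>G\<^esub>, snd d' y)) (\<xi>, 0)"
      using infinitesimal_action_coords[OF yM u(1) c d' y(1) d y(2)]
      by (simp add: w u(2) H_def prod_chart_def)
    also have "snd d y = coord_rep d' d (\<lambda>q. q) (snd d' y)"
      by (rule coord_rep_apply[OF atlas_M d' y(1), symmetric])
    finally show "(coord_rep d' d (\<lambda>q. q) (fst p),
        frechet_derivative H (at (snd c \<one>\<^bsub>G\<^esub>, fst p)) (snd p, 0)) = coord_rep C D F p"
      unfolding rep by (simp add: p)
  qed
qed

section \<open>Correspondence of solutions\<close>

text \<open>The orbit curve of any point \<open>y\<close> along a solution on \<open>G\<close> solves the projected equation. The freedom in
  \<open>y\<close> is what the uniqueness proof relies on.\<close>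

lemma orbit_of_solution:
  assumes J: "open J" and y: "y \<in> points M" and u: "\<And>t. u t \<in> tangent_space A \<one>\<^bsub>G\<^esub>"
    and X: "solution A (left_invariant_rhs G A) u J X"
  shows "solution M infinitesimal_action u J (\<lambda>t. h (X t) y)"
proof -
  have dX: "differentiable_map (interval_atlas J) A X"
    and vX: "\<And>t c. t \<in> J \<Longrightarrow> c \<in> A \<Longrightarrow> X t \<in> fst c \<Longrightarrow>
      snd (left_invariant_rhs G A (X t, u t)) c = velocity_coords J c X t"
    using X unfolding solution_iff[OF atlas_G J] by blast+
  have XA: "X t \<in> points A" if "t \<in> J" for t
    using differentiable_map_points[OF dX] that by (simp add: points_interval_atlas)
  show ?thesis
    unfolding solution_iff[OF atlas_M J]
  proof (intro conjI ballI impI)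
    show "differentiable_map (interval_atlas J) M (\<lambda>t. h (X t) y)"
      using dX differentiable_orbit_map[OF y] by (rule differentiable_map_compose)
    fix t assume t: "t \<in> J"
    show "fst (infinitesimal_action (h (X t) y, u t)) = h (X t) y"
      by (rule fst_infinitesimal_action[OF act_closed[OF XA[OF t] y]])
    fix d assume d: "d \<in> M" "h (X t) y \<in> fst d"
    obtain c where c: "c \<in> A" "X t \<in> fst c" using XA[OF t] by (rule in_pointsE)
    obtain w where w: "left_invariant_rhs G A (X t, u t) = (X t, w)" "w \<in> tangent_space A (X t)"
      using left_invariant_rhs_tangent[OF XA[OF t] u] .
    have "velocity_coords J d (\<lambda>t. h (X t) y) t = chart_derivative c d (\<lambda>X. h X y) (X t) (w c)"
      using velocity_coords_compose[OF dX differentiable_orbit_map[OF y] t c d] vX[OF t c] w(1) by simp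
    also have "\<dots> = snd (tangent_map A M (\<lambda>X. h X y) (left_invariant_rhs G A (X t, u t))) d"
      unfolding w(1)
      by (rule tangent_map_apply[OF manifold_G differentiable_orbit_map[OF y] w(2) c d, symmetric])
    finally show "snd (infinitesimal_action (h (X t) y, u t)) d =
        velocity_coords J d (\<lambda>t. h (X t) y) t"
      by (simp only: orbit_map_left_invariant[OF XA[OF t] y u])
  qed
qed

text \<open>Uniqueness for the projected equation: \<open>z t = h (inv (X t)) (y t)\<close>
  is constant. Its velocity at \<open>s\<close> depends on \<open>y\<close> only through the value and velocity of \<open>y\<close> at \<open>s\<close>. Both are
  shared by the orbit curve \<open>b\<close> of the point \<open>z s\<close>, for which the corresponding curve is constantly \<open>z s\<close>.\<close>

lemma solution_is_orbit:
  assumes J: "open J" "connected J" and u: "\<And>t. u t \<in> tangent_space A \<one>\<^bsub>G\<^esub>"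
    and X: "solution A (left_invariant_rhs G A) u J X"
    and y: "solution M infinitesimal_action u J y"
    and t0: "t0 \<in> J" "y t0 = h (X t0) y0" and y0: "y0 \<in> points M" and t: "t \<in> J"
  shows "h (X t) y0 = y t"
proof -
  have dX: "differentiable_map (interval_atlas J) A X"
    using X unfolding solution_iff[OF atlas_G J(1)] by blast
  have dy: "differentiable_map (interval_atlas J) M y"
    and vy: "\<And>t c. t \<in> J \<Longrightarrow> c \<in> M \<Longrightarrow> y t \<in> fst c \<Longrightarrow>
      snd (infinitesimal_action (y t, u t)) c = velocity_coords J c y t"
    using y unfolding solution_iff[OF atlas_M J(1)] by blast+
  have XA: "X t \<in> points A" and yM: "y t \<in> points M" if "t \<in> J" for t
    using differentiable_map_points[OF dX] differentiable_map_points[OF dy] that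
    by (auto simp: points_interval_atlas)
  let ?V = "\<lambda>t. inv\<^bsub>G\<^esub> (X t)"
  define z where "z = (\<lambda>t. h (?V t) (y t))"
  have dV: "differentiable_map (interval_atlas J) A ?V"
    using dX differentiable_inv by (rule differentiable_map_compose)
  have d_act: "differentiable_map (interval_atlas J) M (\<lambda>t. h (?V t) (b t))"
    if "differentiable_map (interval_atlas J) M b" for b
    using differentiable_map_compose[OF differentiable_map_Pair[OF dV that] differentiable_act] by simp
  have v_act: "velocity_coords J e (\<lambda>t. h (?V t) (b t)) s =
      chart_derivative (prod_chart c d) e (\<lambda>(X, y). h X y) (?V s, b s)
        (velocity_coords J c ?V s, velocity_coords J d b s)"
    if b: "differentiable_map (interval_atlas J) M b" and s: "s \<in> J"
      and c: "c \<in> A" "?V s \<in> fst c" and d: "d \<in> M" "b s \<in> fst d"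
      and e: "e \<in> M" "h (?V s) (b s) \<in> fst e" for b s c d e
    using velocity_coords_compose[OF differentiable_map_Pair[OF dV b] differentiable_act s
        prod_chart_in_prod_atlas[OF c(1) d(1)] _ e(1)]
      chart_derivative_Pair[OF dV b line_chart_in_interval_atlas c(1) d(1) _ c(2) d(2), of 1] c d e s
    by (simp add: prod_chart_def line_chart_simps)
  have "z constant_on J"
  proof (rule zero_velocity_imp_constant[OF J])
    show dz: "differentiable_map (interval_atlas J) M z"
      unfolding z_def by (rule d_act[OF dy])
    fix s e assume s: "s \<in> J" and e: "e \<in> M" "z s \<in> fst e"
    define b where "b = (\<lambda>t. h (X t) (z s))"
    have zM: "z s \<in> points M" using e in_pointsI by metis
    have b: "solution M infinitesimal_action u J b"
      unfolding b_def by (rule orbit_of_solution[OF J(1) zM u X])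
    have db: "differentiable_map (interval_atlas J) M b"
      and vb: "\<And>t c. t \<in> J \<Longrightarrow> c \<in> M \<Longrightarrow> b t \<in> fst c \<Longrightarrow>
        snd (infinitesimal_action (b t, u t)) c = velocity_coords J c b t"
      using b unfolding solution_iff[OF atlas_M J(1)] by blast+
    have bs: "b s = y s"
      unfolding b_def z_def by (rule act_inv(1)[OF XA[OF s] yM[OF s]])
    obtain c where c: "c \<in> A" "?V s \<in> fst c"
      using inv_in[OF XA[OF s]] by (rule in_pointsE)
    obtain d where d: "d \<in> M" "y s \<in> fst d" using yM[OF s] by (rule in_pointsE)
    have "velocity_coords J d y s = velocity_coords J d b s"
      using vy[OF s d] vb[OF s d(1)] d(2) bs by simp
    then have "velocity_coords J e z s = velocity_coords J e (\<lambda>t. h (?V t) (b t)) s"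
      using v_act[OF dy s c d e(1)] v_act[OF db s c d(1) _ e(1)] d(2) e(2) bs
      by (simp add: z_def)
    \<comment> \<open>On \<open>J\<close>, the curve \<open>h (inv (X t)) (b t)\<close> is the constant \<open>z s\<close>.\<close>
    also have "chart_derivative (line_chart J) e (\<lambda>t. h (?V t) (b t)) s =
        chart_derivative (line_chart J) e (\<lambda>_. z s) s"
    proof (rule chart_derivative_cong[OF differentiable_map_const[OF
            topological_atlas_interval[OF J(1)] atlas_M zM] _ line_chart_in_interval_atlas e(1)])
      show "z s = h (?V t) (b t)" if "t \<in> points (interval_atlas J)" for t
        using that XA zM by (simp add: b_def act_inv(2) points_interval_atlas)
    qed (use s e in \<open>auto simp: line_chart_simps\<close>)
    finally show "velocity_coords J e z s = 0"
      by (simp only: chart_derivative_const)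
  qed
  then have "z t = z t0" using t t0 by (auto simp: constant_on_def)
  also have "z t0 = y0" using XA[OF t0(1)] y0 by (simp add: z_def t0(2) act_inv(2))
  finally have "h (X t) y0 = h (X t) (z t)" by simp
  also have "\<dots> = y t" unfolding z_def by (rule act_inv(1)[OF XA[OF t] yM[OF t]])
  finally show ?thesis .
qed

section \<open>Projection along the orbit map\<close>

lemma projects_orbit_map:
  assumes y0: "y0 \<in> points M"
  shows "projects A (lie_algebra_atlas G A) (left_invariant_rhs G A) (\<lambda>X. h X y0) M"
proof -
  let ?T = "tangent_space A \<one>\<^bsub>G\<^esub>" and ?f = "left_invariant_rhs G A" and ?k = "\<lambda>X. h X y0"
  let ?F = "projected_rhs A ?f ?k M"
  have V: "points (lie_algebra_atlas G A) = ?T"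
    by (simp add: lie_algebra_atlas_def points_tangent_space_atlas one_in)
  have surj: "\<exists>X\<in>points A. h X y0 = y" if "y \<in> points M" for y
    using transitive y0 that unfolding transitive_action_def carrier_G by blast
  have F: "?F (y, u) = infinitesimal_action (y, u)" if "y \<in> points M" "u \<in> ?T" for y u
  proof -
    define X where "X = (SOME X. X \<in> points A \<and> h X y0 = y)"
    have X: "X \<in> points A \<and> h X y0 = y"
      unfolding X_def using surj[OF that(1)] unfolding Bex_def by (rule someI_ex)
    have "?F (y, u) = tangent_map A M ?k (?f (X, u))"
      unfolding projected_rhs_def prod.case X_def ..
    also have "\<dots> = infinitesimal_action (h X y0, u)"
      using X y0 that(2) by (intro orbit_map_left_invariant) auto
    finally show ?thesis using X by simp
  qed
  \<comment> \<open>The two right-hand sides agree along curves in \<open>M\<close>.\<close>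
  have sol: "solution M ?F u J y \<longleftrightarrow> solution M infinitesimal_action u J y"
    if u: "\<And>t. u t \<in> ?T" and J: "open J" for u J y
  proof -
    have "?F (y t, u t) = infinitesimal_action (y t, u t)"
      if y: "differentiable_map (interval_atlas J) M y" and t: "t \<in> J" for t
      using differentiable_map_points[OF y, of t] t u
      by (intro F) (simp_all add: points_interval_atlas)
    then show ?thesis
      unfolding solution_iff[OF atlas_M J] by (intro conj_cong refl ball_cong) simp_all
  qed
  have io: "same_io_behaviour A (lie_algebra_atlas G A) ?f ?k M ?F"
    unfolding same_io_behaviour_def
  proof (intro allI impI conjI ballI)
    fix u and J :: "real set" assume adm: "admissible A (lie_algebra_atlas G A) ?f u"
      and "open J \<and> is_interval J \<and> 0 \<in> J"
    then have J: "open J" "connected J" "0 \<in> J" and u: "\<And>t. u t \<in> ?T"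
      by (auto simp: is_interval_connected admissible_def V)
    note sol = sol[OF u J(1)]
    {
      fix X assume X: "solution A ?f u J X"
      show "solution M ?F u J (\<lambda>t. h (X t) y0)"
        unfolding sol by (rule orbit_of_solution[OF J(1) y0 u X])
      show "h (X t) y0 = y t" if "solution M ?F u J y \<and> y 0 = h (X 0) y0" "t \<in> J" for y t
        using that unfolding sol by (intro solution_is_orbit[OF J(1,2) u X _ J(3) _ y0]) auto
    next
      fix y assume "solution M ?F u J y"
      then have y: "solution M infinitesimal_action u J y" unfolding sol .
      then have "y 0 \<in> points M"
        using J(3) differentiable_map_points[of "interval_atlas J" "M" y 0]
        unfolding solution_iff[OF atlas_M J(1)] points_interval_atlas by blast
      then obtain X0 where X0: "X0 \<in> points A" "h X0 y0 = y 0" using surj by blast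
      then obtain X where "solution A ?f u UNIV X" and X: "X 0 = X0"
        using adm unfolding admissible_def by blast
      then have XJ: "solution A ?f u J X"
        using continuous_map_from_subtopology_mono[of euclidean UNIV "mtop A" X J]
        by (simp add: solution_def)
      have "h (X t) y0 = y t" if "t \<in> J" for t
        by (rule solution_is_orbit[OF J(1,2) u XJ y J(3) _ y0 that]) (simp add: X X0)
      then show "\<exists>X. solution A ?f u J X \<and> (\<forall>t\<in>J. h (X t) y0 = y t)"
        using XJ by blast
    }
  qed
  have sys: "is_system M (lie_algebra_atlas G A) ?F"
    unfolding is_system_def
  proof (intro conjI ballI)
    show "smooth_map (prod_atlas M (lie_algebra_atlas G A)) (tangent_bundle_atlas M) ?F"
      unfolding lie_algebra_atlas_def by (rule smooth_infinitesimal_action[OF F])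
    show "fst (?F (y, u)) = y" if "y \<in> points M" "u \<in> points (lie_algebra_atlas G A)" for y u
      using that F[of y u] fst_infinitesimal_action[of y u] by (simp only: V)
  qed
  have act: "tangent_map A M ?k (?f (X, u)) = infinitesimal_action (h X y0, u)"
    if "X \<in> points A" "u \<in> ?T" for X u
    using that y0 by (intro orbit_map_left_invariant)
  show ?thesis
    unfolding projects_def V
  proof (intro conjI ballI impI)
    fix X X' u assume *: "X \<in> points A" "X' \<in> points A" "u \<in> ?T"
    show "tangent_map A M ?k (?f (X, u)) = tangent_map A M ?k (?f (X', u))" if "h X y0 = h X' y0"
      unfolding act[OF *(1,3)] act[OF *(2,3)] that ..
    show "tangent_map A M ?k (?f (X, u)) = ?F (h X y0, u)"
      unfolding act[OF *(1,3)] F[OF act_closed[OF *(1) y0] *(3)] ..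
  qed (fact surj sys io)+
qed

end

theorem theorem5:
  fixes G :: "('g, 'z) monoid_scheme"
    and A :: "('g, 'e::real_normed_vector) atlas"
    and M :: "('m, 'f::real_normed_vector) atlas"
    and h :: "'g \<Rightarrow> 'm \<Rightarrow> 'm"
    and y0 :: 'm
  assumes "lie_group G A" and "connected_space (mtop A)"
    and "smooth_manifold M" and "connected_space (mtop M)"
    and "smooth_map (prod_atlas A M) M (\<lambda>(X, y). h X y)"
    and "right_action G (points M) h" and "transitive_action G (points M) h"
    and "y0 \<in> points M"
  shows "projects A (lie_algebra_atlas G A) (left_invariant_rhs G A) (\<lambda>X. h X y0) M"
proof -
  interpret smooth_transitive_right_action G A M h
    using assms by (intro smooth_transitive_right_action.intro)
  show ?thesis using \<open>y0 \<in> points M\<close> by (rule projects_orbit_map)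
qed

end
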